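(* For every $k\ge1$, $\mathsf{TT}^1_k$ admits strong avoidance of bounded enumeration if and only if it admits $\Pi^0_1$-class avoidance of bounded enumeration.
   Context: $\mathsf{TT}^1_k$: every coloring $C:2^{<\omega}\to k$ (an instance) has a solution, namely an infinite perfect tree $T\subseteq 2^{<\omega}$ (a subset isomorphic to $2^{<\omega}$ under the initial-segment order) on which $C$ is constant. For $S\subseteq 2^{<\omega}$ and $l\in\omega$, an $l$-enumeration of $S$ is $g:\omega\to$ (finite subsets of $2^{<\omega}$) with $|g(n)|\le l$ and $g(n)\cap S\cap 2^n\ne\emptyset$ for all $n$; a bounded enumeration is an $l$-enumeration for some $l$. $\mathsf{TT}^1_k$ admits strong avoidance of bounded enumeration if for every $D\subseteq\omega$, every $S\subseteq 2^{<\omega}$ with no $D$-computable bounded enumeration, and every instance $C$, some solution $T$ of $C$ is such that $D\oplus T$ computes no bounded enumeration of $S$. $\mathsf{TT}^1_k$ admits $\Pi^0_1$-class avoidance of bounded enumeration if for every $D\subseteq\omega$, every $S\subseteq 2^{<\omega}$ with no $D$-computable bounded enumeration, and every nonempty $\Pi^{0,D}_1$-class $Q$ of colorings $2^{<\omega}\to k$, there are $C\in Q$ and a solution $T$ of $C$ such that $D\oplus T$ computes no bounded enumeration of $S$. *)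

theory Defs
  imports Main "HOL-Library.Nat_Bijection" "HOL-Library.Sublist"
begin

text \<open>
  Relative computability.  A \<open>functional\<close> is a program for a partial recursive function of one
  number with access to a set of natural numbers; several arguments are passed through the pairing
  function \<^const>\<open>prod_encode\<close>.
\<close>

datatype functional =
    Query | Zero | Succ | Fst | Snd
  | Pair functional functional
  | Comp functional functional
  | Prec functional functional
  | Mu functional

primrec run :: "functional \<Rightarrow> nat set \<Rightarrow> nat \<rightharpoonup> nat" where
  "run Query X = (\<lambda>n. Some (of_bool (n \<in> X)))"
| "run Zero X = (\<lambda>n. Some 0)"
| "run Succ X = (\<lambda>n. Some (Suc n))"
| "run Fst X = (\<lambda>n. Some (fst (prod_decode n)))"
| "run Snd X = (\<lambda>n. Some (snd (prod_decode n)))"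
| "run (Pair e f) X =
     (\<lambda>n. Option.bind (run e X n) (\<lambda>a. Option.bind (run f X n) (\<lambda>b. Some (prod_encode (a, b)))))"
| "run (Comp e f) X = (\<lambda>n. Option.bind (run f X n) (run e X))"
| "run (Prec e f) X =
     (\<lambda>n. rec_nat (run e X (fst (prod_decode n)))
        (\<lambda>m r. Option.bind r
           (\<lambda>v. run f X (prod_encode (fst (prod_decode n), prod_encode (m, v)))))
        (snd (prod_decode n)))"
| "run (Mu e) X =
     (\<lambda>n. if \<exists>m. run e X (prod_encode (n, m)) = Some 0 \<and>
                 (\<forall>i<m. run e X (prod_encode (n, i)) \<noteq> None)
          then Some (LEAST m. run e X (prod_encode (n, m)) = Some 0)
          else None)"

definition computable_from :: "nat set \<Rightarrow> (nat \<Rightarrow> nat) \<Rightarrow> bool" where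
  "computable_from X f \<longleftrightarrow> (\<exists>e. \<forall>n. run e X n = Some (f n))"

definition computable_set_from :: "nat set \<Rightarrow> nat set \<Rightarrow> bool" where
  "computable_set_from X A \<longleftrightarrow> computable_from X (\<lambda>n. of_bool (n \<in> A))"

definition join :: "nat set \<Rightarrow> nat set \<Rightarrow> nat set" where
  "join A B = {2 * n |n. n \<in> A} \<union> {2 * n + 1 |n. n \<in> B}"


text \<open>
  Elements of $2^{<\omega}$ are values of type \<^typ>\<open>bool list\<close>, with initial segment \<^const>\<open>prefix\<close>.
  They are identified with the natural numbers through the following bijection, which lists them
  by increasing length.
\<close>

primrec string_code :: "bool list \<Rightarrow> nat" where
  "string_code [] = 0"
| "string_code (b # s) = 2 * string_code s + (if b then 2 else 1)"

lemma bij_string_code: "bij string_code"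
proof (rule bijI)
  show "inj string_code"
  proof (rule injI)
    fix s t assume "string_code s = string_code t"
    then show "s = t"
    proof (induction s arbitrary: t)
      case Nil
      then show ?case by (cases t) (auto split: if_splits)
    next
      case (Cons b s)
      then obtain c t' where t: "t = c # t'" by (cases t) (auto split: if_splits)
      have "b = c" using Cons.prems unfolding t by (cases b; cases c; simp) presburger+
      with Cons t show ?case by (auto split: if_splits)
    qed
  qed
next
  have "\<exists>s. string_code s = n" for n
  proof (induction n rule: less_induct)
    case (less n)
    show ?case
    proof (cases "n = 0")
      case True
      then have "string_code [] = n" by simp
      then show ?thesis ..
    next
      case False
      then have "(n - 1) div 2 < n" by simp
      then obtain s where s: "string_code s = (n - 1) div 2" using less.IH by blast
      have "string_code (even n # s) = n" using s False by (auto elim!: evenE oddE)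
      then show ?thesis ..
    qed
  qed
  then show "surj string_code" by (metis surjI)
qed


text \<open>A function into the finite sets of strings is computed through their canonical indices.\<close>

definition l_enumeration :: "nat \<Rightarrow> bool list set \<Rightarrow> (nat \<Rightarrow> bool list set) \<Rightarrow> bool" where
  "l_enumeration l S g \<longleftrightarrow>
     (\<forall>n. finite (g n) \<and> card (g n) \<le> l \<and> g n \<inter> S \<inter> {s. length s = n} \<noteq> {})"

definition bounded_enumeration :: "bool list set \<Rightarrow> (nat \<Rightarrow> bool list set) \<Rightarrow> bool" where
  "bounded_enumeration S g \<longleftrightarrow> (\<exists>l. l_enumeration l S g)"

definition computes_bounded_enumeration :: "nat set \<Rightarrow> bool list set \<Rightarrow> bool" where
  "computes_bounded_enumeration X S \<longleftrightarrow>
     (\<exists>g. bounded_enumeration S g \<and> computable_from X (\<lambda>n. set_encode (string_code ` g n)))"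


definition colorings :: "nat \<Rightarrow> (bool list \<Rightarrow> nat) set" where
  "colorings k = {C. \<forall>s. C s < k}"

definition perfect_tree :: "bool list set \<Rightarrow> bool" where
  "perfect_tree T \<longleftrightarrow>
     (\<exists>h :: bool list \<Rightarrow> bool list. bij_betw h UNIV T \<and> (\<forall>s t. prefix (h s) (h t) \<longleftrightarrow> prefix s t))"

definition TT1_solution :: "(bool list \<Rightarrow> nat) \<Rightarrow> bool list set \<Rightarrow> bool" where
  "TT1_solution C T \<longleftrightarrow> perfect_tree T \<and> (\<exists>c. \<forall>s\<in>T. C s = c)"

text \<open>The code of the restriction of a coloring to the first \<open>n\<close> strings.\<close>

definition restriction_code :: "(bool list \<Rightarrow> nat) \<Rightarrow> nat \<Rightarrow> nat" where
  "restriction_code C n = list_encode (map (\<lambda>i. C (inv string_code i)) [0..<n])"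

text \<open>
  Membership in a $\Pi^{0,D}_1$-class is a condition $\forall n\; R(C \restriction n)$ with
  \<open>R\<close> computable from \<open>D\<close>.
\<close>

definition Pi01_class :: "nat set \<Rightarrow> nat \<Rightarrow> (bool list \<Rightarrow> nat) set \<Rightarrow> bool" where
  "Pi01_class D k Q \<longleftrightarrow>
     (\<exists>R. computable_set_from D R \<and> Q = {C \<in> colorings k. \<forall>n. restriction_code C n \<in> R})"


definition strong_avoidance :: "nat \<Rightarrow> bool" where
  "strong_avoidance k \<longleftrightarrow>
     (\<forall>D S. \<not> computes_bounded_enumeration D S \<longrightarrow>
        (\<forall>C \<in> colorings k. \<exists>T. TT1_solution C T \<and>
           \<not> computes_bounded_enumeration (join D (string_code ` T)) S))"

definition Pi01_class_avoidance :: "nat \<Rightarrow> bool" where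
  "Pi01_class_avoidance k \<longleftrightarrow>
     (\<forall>D S. \<not> computes_bounded_enumeration D S \<longrightarrow>
        (\<forall>Q. Pi01_class D k Q \<and> Q \<noteq> {} \<longrightarrow>
           (\<exists>C \<in> Q. \<exists>T. TT1_solution C T \<and>
              \<not> computes_bounded_enumeration (join D (string_code ` T)) S)))"

end

theory Submission
  imports Defs "HOL-Library.Countable" "HOL-Library.FuncSet"
begin

text \<open>
  The interesting direction derives strong avoidance from avoidance for $\Pi^0_1$-classes. An arbitrary
  two-colouring $P$ is treated by forcing with conditions that consist of a finite part of the solution
  and of reservoirs (perfect trees computing no bounded enumeration of $S$). If neither colour has a
  solution then every condition extends to a stuck one, no extension of which forces some fixed
  functional $\Phi$ to fail to be an $l$-enumeration. Finitely many stuck conditions are combined so that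
  every assignment of colours to their reservoirs agrees with one of them. For a finite set $V$ of
  strings let $Q_V$ be the $\Pi^0_1$-class of colourings of the reservoirs for which no finite
  extension of one of these conditions makes its $\Phi(n)$ converge to a set disjoint from $V$. For
  $V = S \cap 2^n$ it is nonempty: otherwise the true colouring gives an extension that forces
  $\Phi(n)$ to miss $S \cap 2^n$. If the sets $V$ with $Q_V \neq \emptyset$ had no small hitting set,
  thin the reservoirs, by the hypothesis, to trees homogeneous for one member of each $Q_V$; by
  pigeonhole some condition then forces its $\Phi(n)$ to meet too many sets $V$ to have at most $l$
  elements. So small hitting sets exist for all $n$, and searching for them is a bounded enumeration of $S$.
\<close>

section \<open>Closure properties of relative computability\<close>

text \<open>The obstacle is that the given colouring is not computable, so no search can recognize
  the extensions that have the correct colour. The search therefore ranges over all colourings, and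
  a homogeneous solution taken from a class may carry the colour opposite to that of a given
  condition. Hence stuck conditions for both colours are needed at once: whatever colours a
  homogeneous solution gives to the reservoirs, one of the conditions accepts them. The colourings
  of the \<open>N\<close> reservoirs are read as one colouring with \<open>2 ^ N\<close> colours, so
  that a single embedding thins all of them in parallel. The bound of the enumeration is the sum of
  the bounds \<open>l\<close> of the combined conditions: each \<open>V\<close> is charged to a
  condition that accepts its homogeneous colour, and one value of that functional meets every
  \<open>V\<close> charged to it. Emptiness of \<open>Q_V\<close> is semidecidable by compactness,
  so a hitting set can be recognized without knowing which \<open>V\<close> is the trace of
  \<open>S\<close>; that trace is hit because its class is nonempty. More than two colours are
  handled by separating one colour at a time.\<close>

abbreviation p1 :: "nat \<Rightarrow> nat" where "p1 x \<equiv> fst (prod_decode x)"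
abbreviation p2 :: "nat \<Rightarrow> nat" where "p2 x \<equiv> snd (prod_decode x)"

definition decidable_from :: "nat set \<Rightarrow> (nat \<Rightarrow> bool) \<Rightarrow> bool" where
  "decidable_from A P \<longleftrightarrow> computable_from A (\<lambda>x. of_bool (P x))"

named_theorems comp_intros

lemma comp_id [comp_intros]: "computable_from A (\<lambda>x. x)"
  unfolding computable_from_def by (rule exI[of _ "Pair Fst Snd"]) simp

lemma comp_compose:
  assumes "computable_from A f" "computable_from A g"
  shows "computable_from A (\<lambda>x. f (g x))"
proof -
  from assms obtain e e' where "\<forall>n. run e A n = Some (f n)" "\<forall>n. run e' A n = Some (g n)"
    unfolding computable_from_def by blast
  then show ?thesis unfolding computable_from_def by (intro exI[of _ "Comp e e'"]) simp
qed

lemma comp_Suc [comp_intros]: "computable_from A f \<Longrightarrow> computable_from A (\<lambda>x. Suc (f x))"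
  by (rule comp_compose[of A Suc], unfold computable_from_def, rule exI[of _ Succ]) auto

lemma comp_const [comp_intros]: "computable_from A (\<lambda>x. c)"
proof (induction c)
  case 0
  show ?case unfolding computable_from_def by (rule exI[of _ Zero]) simp
qed (rule comp_Suc)

lemma comp_pair [comp_intros]:
  assumes "computable_from A f" "computable_from A g"
  shows "computable_from A (\<lambda>x. prod_encode (f x, g x))"
proof -
  from assms obtain e e' where "\<forall>n. run e A n = Some (f n)" "\<forall>n. run e' A n = Some (g n)"
    unfolding computable_from_def by blast
  then show ?thesis unfolding computable_from_def by (intro exI[of _ "Pair e e'"]) simp
qed

lemma comp_fst [comp_intros]: "computable_from A f \<Longrightarrow> computable_from A (\<lambda>x. p1 (f x))"
  by (rule comp_compose[of A p1], unfold computable_from_def, rule exI[of _ Fst]) auto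

lemma comp_snd [comp_intros]: "computable_from A f \<Longrightarrow> computable_from A (\<lambda>x. p2 (f x))"
  by (rule comp_compose[of A p2], unfold computable_from_def, rule exI[of _ Snd]) auto

lemma comp_compose2:
  assumes "computable_from A (\<lambda>p. h (p1 p) (p2 p))" "computable_from A f" "computable_from A g"
  shows "computable_from A (\<lambda>x. h (f x) (g x))"
  using comp_compose[OF assms(1) comp_pair[OF assms(2,3)]] by simp

lemma comp_rec [comp_intros]:
  assumes "computable_from A a" "computable_from A n"
    and "computable_from A (\<lambda>p. f (p1 p) (p1 (p2 p)) (p2 (p2 p)))"
  shows "computable_from A (\<lambda>x. rec_nat (a x) (\<lambda>m r. f x m r) (n x))"
proof -
  from assms(1,3) obtain e e' where e: "\<forall>n. run e A n = Some (a n)"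
    "\<forall>p. run e' A p = Some (f (p1 p) (p1 (p2 p)) (p2 (p2 p)))"
    unfolding computable_from_def by blast
  have "run (Prec e e') A p = Some (rec_nat (a (p1 p)) (\<lambda>m r. f (p1 p) m r) (p2 p))" for p
  proof -
    have "rec_nat (run e A x) (\<lambda>m r. Option.bind r (\<lambda>v. run e' A (prod_encode (x, prod_encode (m, v))))) k
      = Some (rec_nat (a x) (\<lambda>m r. f x m r) k)" for x k
      by (induction k) (use e in auto)
    then show ?thesis by simp
  qed
  then have "computable_from A (\<lambda>p. rec_nat (a (p1 p)) (\<lambda>m r. f (p1 p) m r) (p2 p))"
    unfolding computable_from_def by blast
  from comp_compose2[OF this comp_id assms(2)] show ?thesis .
qed

lemma comp_of_bool [comp_intros]: "decidable_from A P \<Longrightarrow> computable_from A (\<lambda>x. of_bool (P x))"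
  unfolding decidable_from_def .

lemma comp_if [comp_intros]:
  assumes "decidable_from A P" "computable_from A f" "computable_from A g"
  shows "computable_from A (\<lambda>x. if P x then f x else g x)"
proof -
  have "computable_from A (\<lambda>x. rec_nat (g x) (\<lambda>m r. f x) (of_bool (P x)))"
    using assms by (intro comp_intros comp_compose[OF assms(2)])
  moreover have "(\<lambda>x. rec_nat (g x) (\<lambda>m r. f x) (of_bool (P x))) = (\<lambda>x. if P x then f x else g x)"
    by auto
  ultimately show ?thesis by simp
qed

lemma comp_pred [comp_intros]:
  assumes "computable_from A f"
  shows "computable_from A (\<lambda>x. f x - Suc 0)"
proof -
  have "computable_from A (\<lambda>x. rec_nat 0 (\<lambda>m r. m) (f x))"
    by (intro comp_intros assms)
  moreover have "rec_nat 0 (\<lambda>m r. m) y = y - Suc 0" for y by (cases y) auto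
  ultimately show ?thesis by simp
qed

lemma comp_diff [comp_intros]:
  assumes "computable_from A f" "computable_from A g"
  shows "computable_from A (\<lambda>x. f x - g x)"
proof -
  have "computable_from A (\<lambda>x. rec_nat (f x) (\<lambda>m r. r - Suc 0) (g x))"
    by (intro comp_intros assms)
  moreover have "rec_nat y (\<lambda>m r. r - Suc 0) z = y - z" for y z by (induction z) auto
  ultimately show ?thesis by simp
qed

lemma comp_add [comp_intros]:
  assumes "computable_from A f" "computable_from A g"
  shows "computable_from A (\<lambda>x. f x + g x)"
proof -
  have "computable_from A (\<lambda>x. rec_nat (f x) (\<lambda>m r. Suc r) (g x))"
    by (intro comp_intros assms)
  moreover have "rec_nat y (\<lambda>m r. Suc r) z = y + z" for y z by (induction z) auto
  ultimately show ?thesis by simp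
qed

lemma comp_mult [comp_intros]:
  assumes "computable_from A f" "computable_from A g"
  shows "computable_from A (\<lambda>x. f x * g x)"
proof -
  have "computable_from A (\<lambda>x. rec_nat 0 (\<lambda>m r. r + f x) (g x))"
    by (intro comp_intros assms comp_compose[OF assms(1)])
  moreover have "rec_nat 0 (\<lambda>m r. r + y) z = y * z" for y z :: nat by (induction z) auto
  ultimately show ?thesis by simp
qed

lemma comp_power [comp_intros]:
  assumes "computable_from A f" "computable_from A g"
  shows "computable_from A (\<lambda>x. f x ^ g x)"
proof -
  have "computable_from A (\<lambda>x. rec_nat 1 (\<lambda>m r. r * f x) (g x))"
    by (intro comp_intros assms comp_compose[OF assms(1)])
  moreover have "rec_nat 1 (\<lambda>m r. r * y) z = y ^ z" for y z :: nat by (induction z) auto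
  ultimately show ?thesis by simp
qed

lemma dec_compose:
  assumes "decidable_from A P" "computable_from A g"
  shows "decidable_from A (\<lambda>x. P (g x))"
  using assms comp_compose[of A "\<lambda>x. of_bool (P x)" g] unfolding decidable_from_def by simp

lemma dec_compose2:
  assumes "decidable_from A (\<lambda>p. P (p1 p) (p2 p))" "computable_from A f" "computable_from A g"
  shows "decidable_from A (\<lambda>x. P (f x) (g x))"
  using dec_compose[OF assms(1) comp_pair[OF assms(2,3)]] by simp

lemma dec_const [comp_intros]: "decidable_from A (\<lambda>x. b)"
  unfolding decidable_from_def by (rule comp_const)

lemma dec_not [comp_intros]:
  assumes "decidable_from A P" shows "decidable_from A (\<lambda>x. \<not> P x)"
proof -
  have "computable_from A (\<lambda>x. if P x then 0 else 1)" by (intro comp_intros assms)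
  moreover have "(\<lambda>x. if P x then 0 else 1) = (\<lambda>x. of_bool (\<not> P x) :: nat)" by auto
  ultimately show ?thesis unfolding decidable_from_def by simp
qed

lemma dec_if [comp_intros]:
  assumes "decidable_from A P" "decidable_from A Q" "decidable_from A R"
  shows "decidable_from A (\<lambda>x. if P x then Q x else R x)"
proof -
  have "computable_from A (\<lambda>x. if P x then of_bool (Q x) else of_bool (R x))"
    by (intro comp_intros assms)
  moreover have "(\<lambda>x. if P x then of_bool (Q x) else of_bool (R x))
    = (\<lambda>x. of_bool (if P x then Q x else R x) :: nat)" by auto
  ultimately show ?thesis unfolding decidable_from_def by simp
qed

lemma dec_conj [comp_intros]:
  assumes "decidable_from A P" "decidable_from A Q" shows "decidable_from A (\<lambda>x. P x \<and> Q x)"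
proof -
  have "decidable_from A (\<lambda>x. if P x then Q x else False)" by (intro dec_if dec_const assms)
  moreover have "(\<lambda>x. if P x then Q x else False) = (\<lambda>x. P x \<and> Q x)" by auto
  ultimately show ?thesis by simp
qed

lemma dec_disj [comp_intros]:
  assumes "decidable_from A P" "decidable_from A Q" shows "decidable_from A (\<lambda>x. P x \<or> Q x)"
proof -
  have "decidable_from A (\<lambda>x. \<not> (\<not> P x \<and> \<not> Q x))" by (intro comp_intros assms)
  then show ?thesis by simp
qed

lemma dec_imp [comp_intros]:
  assumes "decidable_from A P" "decidable_from A Q" shows "decidable_from A (\<lambda>x. P x \<longrightarrow> Q x)"
proof -
  have "decidable_from A (\<lambda>x. \<not> P x \<or> Q x)" by (intro comp_intros assms)
  then show ?thesis unfolding imp_conv_disj .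
qed

lemma dec_iff [comp_intros]:
  assumes "decidable_from A P" "decidable_from A Q"
  shows "decidable_from A (\<lambda>x. P x \<longleftrightarrow> Q x)"
proof -
  have "decidable_from A (\<lambda>x. (P x \<longrightarrow> Q x) \<and> (Q x \<longrightarrow> P x))" by (intro comp_intros assms)
  moreover have "(\<lambda>x. (P x \<longrightarrow> Q x) \<and> (Q x \<longrightarrow> P x)) = (\<lambda>x. P x \<longleftrightarrow> Q x)" by auto
  ultimately show ?thesis by simp
qed

lemma dec_zero:
  assumes "computable_from A f" shows "decidable_from A (\<lambda>x. f x = 0)"
proof -
  have "computable_from A (\<lambda>x. 1 - f x)" by (intro comp_intros assms)
  moreover have "(\<lambda>x. 1 - f x) = (\<lambda>x. of_bool (f x = 0))" by auto
  ultimately show ?thesis unfolding decidable_from_def by simp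
qed

lemma dec_le [comp_intros]:
  assumes "computable_from A f" "computable_from A g" shows "decidable_from A (\<lambda>x. f x \<le> g x)"
proof -
  have "decidable_from A (\<lambda>x. f x - g x = 0)" by (intro dec_zero comp_intros assms)
  then show ?thesis by simp
qed

lemma dec_less [comp_intros]:
  assumes "computable_from A f" "computable_from A g" shows "decidable_from A (\<lambda>x. f x < g x)"
proof -
  have "decidable_from A (\<lambda>x. Suc (f x) \<le> g x)" by (intro comp_intros assms)
  then show ?thesis by (simp add: Suc_le_eq)
qed

lemma dec_eq [comp_intros]:
  assumes "computable_from A f" "computable_from A g" shows "decidable_from A (\<lambda>x. f x = g x)"
proof -
  have "decidable_from A (\<lambda>x. f x \<le> g x \<and> g x \<le> f x)" by (intro comp_intros assms)
  then show ?thesis by (simp add: eq_iff)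
qed

lemma dec_ball [comp_intros]:
  assumes "computable_from A f" "decidable_from A (\<lambda>p. P (p1 p) (p2 p))"
  shows "decidable_from A (\<lambda>x. \<forall>i<f x. P x i)"
proof -
  have "decidable_from A (\<lambda>p. P (p1 p) (p1 (p2 p)))"
    by (intro comp_intros dec_compose2[OF assms(2)])
  then have "computable_from A (\<lambda>x. rec_nat 1 (\<lambda>m r. if P x m then r else 0) (f x))"
    by (intro comp_intros assms)
  moreover have "rec_nat (1::nat) (\<lambda>m r. if P x m then r else 0) k = of_bool (\<forall>i<k. P x i)" for x k
    by (induction k) (auto simp: less_Suc_eq)
  ultimately show ?thesis unfolding decidable_from_def by simp
qed

lemma dec_bex [comp_intros]:
  assumes "computable_from A f" "decidable_from A (\<lambda>p. P (p1 p) (p2 p))"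
  shows "decidable_from A (\<lambda>x. \<exists>i<f x. P x i)"
proof -
  have "decidable_from A (\<lambda>x. \<not> (\<forall>i<f x. \<not> P x i))" by (intro comp_intros assms)
  then show ?thesis by simp
qed

lemma dec_fin_bex:
  assumes "finite I" "\<And>i. i \<in> I \<Longrightarrow> decidable_from A (P i)"
  shows "decidable_from A (\<lambda>x. \<exists>i\<in>I. P i x)"
  using assms
proof (induction I)
  case (insert a I)
  then have "decidable_from A (\<lambda>x. P a x \<or> (\<exists>i\<in>I. P i x))" by (intro dec_disj) auto
  then show ?case by simp
qed (simp add: dec_const)

lemma comp_Least [comp_intros]:
  assumes "decidable_from A (\<lambda>p. P (p1 p) (p2 p))" "\<And>x. \<exists>m. P x m"
  shows "computable_from A (\<lambda>x. LEAST m. P x m)"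
proof -
  have "computable_from A (\<lambda>p. of_bool (\<not> P (p1 p) (p2 p)))"
    by (intro comp_intros assms)
  then obtain e where e: "\<forall>p. run e A p = Some (of_bool (\<not> P (p1 p) (p2 p)))"
    unfolding computable_from_def by blast
  have "run (Mu e) A x = Some (LEAST m. P x m)" for x
    using e assms(2)[of x] by simp
  then show ?thesis unfolding computable_from_def by blast
qed

lemma comp_div [comp_intros]:
  assumes "computable_from A f" "computable_from A g"
  shows "computable_from A (\<lambda>x. f x div g x)"
proof -
  \<comment> \<open>The disjunct \<open>z = 0\<close> keeps the search total; for a zero divisor it
    stops at 0, the value of \<open>y div 0\<close>.\<close>
  have *: "(LEAST q. z = 0 \<or> y < Suc q * z) = y div z" for y z :: nat
  proof (cases "z = 0")
    case False
    show ?thesis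
    proof (rule Least_equality)
      show "z = 0 \<or> y < Suc (y div z) * z"
        using False by (metis dividend_less_div_times mult_Suc neq0_conv)
      show "y div z \<le> q" if "z = 0 \<or> y < Suc q * z" for q
        using that False by (metis less_Suc_eq_le less_mult_imp_div_less)
    qed
  qed (simp add: Least_equality)
  have "computable_from A (\<lambda>x. LEAST q. g x = 0 \<or> f x < Suc q * g x)"
  proof (intro comp_intros comp_compose[OF assms(1)] comp_compose[OF assms(2)])
    show "\<exists>q. g x = 0 \<or> f x < Suc q * g x" for x
      by (rule exI[of _ "f x"]) (cases "g x", auto)
  qed
  then show ?thesis unfolding * .
qed

lemma comp_mod [comp_intros]:
  assumes "computable_from A f" "computable_from A g"
  shows "computable_from A (\<lambda>x. f x mod g x)"
proof -
  have "computable_from A (\<lambda>x. f x - (f x div g x) * g x)" by (intro comp_intros assms)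
  then show ?thesis by (simp add: minus_div_mult_eq_mod)
qed

lemma dec_odd [comp_intros]:
  assumes "computable_from A f" shows "decidable_from A (\<lambda>x. odd (f x))"
proof -
  have "decidable_from A (\<lambda>x. f x mod 2 = 1)" by (intro comp_intros assms)
  then show ?thesis by (simp add: odd_iff_mod_2_eq_one)
qed

lemma dec_set_decode [comp_intros]:
  assumes "computable_from A f" "computable_from A g"
  shows "decidable_from A (\<lambda>x. f x \<in> set_decode (g x))"
proof -
  have "decidable_from A (\<lambda>x. odd (g x div 2 ^ f x))" by (intro comp_intros assms)
  then show ?thesis by (simp add: set_decode_def)
qed

lemma dec_Query: "decidable_from A (\<lambda>x. x \<in> A)"
  unfolding decidable_from_def computable_from_def by (rule exI[of _ Query]) simp

text \<open>Finitely many programs are hard-wired into one, so nothing uniform in \<open>i\<close>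
  is asked. With each \<open>f i\<close> constant this makes every finite table computable.\<close>

lemma comp_cases:
  assumes "\<And>i. i < N \<Longrightarrow> computable_from A (f i)" "computable_from A g" "computable_from A a"
  shows "computable_from A (\<lambda>x. if a x < (N::nat) then f (a x) (g x) else 0)"
  using assms(1)
proof (induction N)
  case (Suc N)
  have "computable_from A (\<lambda>x. f N (g x))" by (rule comp_compose[OF Suc.prems assms(2)]) simp
  moreover have "computable_from A (\<lambda>x. if a x < N then f (a x) (g x) else 0)"
    using Suc by simp
  ultimately have "computable_from A (\<lambda>x. if a x = N then f N (g x) else if a x < N then f (a x) (g x) else 0)"
    by (rule comp_if[OF dec_eq[OF assms(3) comp_const]])
  moreover have "(\<lambda>x. if a x = N then f N (g x) else if a x < N then f (a x) (g x) else 0)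
    = (\<lambda>x. if a x < Suc N then f (a x) (g x) else 0)" by (rule ext) (simp add: less_Suc_eq)
  ultimately show ?case by (simp only:)
qed (simp add: comp_const)


subsection \<open>Finite sequences\<close>

text \<open>A nonempty list is coded as the successor of the pair of its head and the code of its
  tail, hence the subtractions of 1. The function is total, so any number can serve as a sequence of
  certificates.\<close>

definition entry :: "nat \<Rightarrow> nat \<Rightarrow> nat" where
  "entry x i = p1 (rec_nat x (\<lambda>m r. p2 (r - 1)) i - 1)"

lemma comp_entry [comp_intros]:
  assumes "computable_from A f" "computable_from A g"
  shows "computable_from A (\<lambda>x. entry (f x) (g x))"
  unfolding entry_def by (intro comp_intros assms)

lemma iterated_tail: "rec_nat (list_encode xs) (\<lambda>m r. p2 (r - 1)) i = list_encode (drop i xs)"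
proof (induction i)
  case (Suc i)
  have 0: "p2 0 = 0" using prod_encode_inverse[of "(0, 0)"] by (simp add: prod_encode_def)
  have "drop (Suc i) xs = tl (drop i xs)" by (simp add: drop_Suc tl_drop)
  with Suc show ?case by (cases "drop i xs") (simp_all add: 0)
qed simp

lemma entry_list_encode:
  assumes "i < length xs" shows "entry (list_encode xs) i = xs ! i"
  unfolding entry_def iterated_tail using assms by (simp add: Cons_nth_drop_Suc[symmetric])

lemma comp_list_length [comp_intros]:
  assumes "computable_from A f" shows "computable_from A (\<lambda>x. length (list_decode (f x)))"
proof -
  let ?t = "\<lambda>x i. rec_nat x (\<lambda>m r. p2 (r - 1)) i"
  have t: "?t x i = 0 \<longleftrightarrow> length (list_decode x) \<le> i" for x i
    using iterated_tail[of "list_decode x" i] by (cases "drop i (list_decode x)") auto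
  have "computable_from A (\<lambda>x. LEAST i. ?t x i = 0)"
  proof (intro comp_intros)
    show "\<exists>i. ?t x i = 0" for x unfolding t by blast
  qed
  moreover have "(LEAST i. ?t x i = 0) = length (list_decode x)" for x
    unfolding t by (rule Least_equality) auto
  ultimately have "computable_from A (\<lambda>x. length (list_decode x))" by simp
  from comp_compose[OF this assms] show ?thesis .
qed

lemma ex_entry: "\<exists>x. \<forall>i<n. entry x i = f i"
  by (rule exI[of _ "list_encode (map f [0..<n])"]) (simp add: entry_list_encode)

text \<open>Segments of length \<open>n\<close> of a colouring with \<open>K\<close> colours are
  kept as numbers below \<open>K ^ n\<close>: a quantifier over all of them is then bounded, and
  shortening a segment to length \<open>m\<close> is reduction modulo \<open>K ^ m\<close>.\<close>

definition digit :: "nat \<Rightarrow> nat \<Rightarrow> nat \<Rightarrow> nat" where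
  "digit K r i = r div K ^ i mod K"

lemma comp_digit [comp_intros]:
  assumes "computable_from A f" "computable_from A g"
  shows "computable_from A (\<lambda>x. digit K (f x) (g x))"
  unfolding digit_def by (intro comp_intros assms)

definition digits :: "nat \<Rightarrow> nat \<Rightarrow> (nat \<Rightarrow> nat) \<Rightarrow> nat" where
  "digits K n f = (\<Sum>i<n. f i * K ^ i)"

lemma digits_less:
  assumes "\<And>i. i < n \<Longrightarrow> f i < K" shows "digits K n f < K ^ n"
  using assms
proof (induction n)
  case (Suc n)
  then have "digits K n f < K ^ n" by simp
  moreover have "Suc (f n) * K ^ n \<le> K * K ^ n" using Suc.prems[of n] by (intro mult_right_mono) auto
  ultimately show ?case by (simp add: digits_def)
qed (simp add: digits_def)

lemma digit_digits:
  assumes "\<And>i. i < n \<Longrightarrow> f i < K" "i < n"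
  shows "digit K (digits K n f) i = f i"
  using assms
proof (induction n)
  case (Suc n)
  have *: "digits K (Suc n) f = digits K n f + f n * K ^ n" by (simp add: digits_def)
  have lt: "digits K n f < K ^ n" using Suc.prems by (intro digits_less) auto
  have K: "K > 0" using Suc.prems(1)[of i] Suc.prems(2) by auto
  show ?case
  proof (cases "i = n")
    case True
    then show ?thesis using lt K Suc.prems(1)[of n] unfolding digit_def * by simp
  next
    case False
    then have i: "i < n" using Suc.prems by simp
    then have "K ^ n = K ^ (Suc (n - Suc i)) * K ^ i" by (metis Suc_diff_Suc le_add_diff_inverse2 less_imp_le_nat power_add)
    then have "digits K n f + f n * K ^ n = digits K n f + (f n * K ^ (n - Suc i) * K) * K ^ i"
      by (simp add: algebra_simps)
    then have "(digits K n f + f n * K ^ n) div K ^ i = digits K n f div K ^ i + f n * K ^ (n - Suc i) * K"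
      using K div_mult_self1[of "K ^ i" "digits K n f" "f n * K ^ (n - Suc i) * K"]
      by (metis add.commute neq0_conv power_not_zero)
    then have "digit K (digits K (Suc n) f) i = digit K (digits K n f) i" unfolding digit_def * by simp
    then show ?thesis using Suc i by simp
  qed
qed simp

lemma digits_digit:
  assumes "K > 0" shows "digits K n (digit K r) = r mod K ^ n"
proof (induction n)
  case (Suc n)
  have "digits K (Suc n) (digit K r) = r mod K ^ n + K ^ n * (r div K ^ n mod K)"
    using Suc by (simp add: digits_def digit_def)
  also have "\<dots> = r mod K ^ Suc n" by (simp add: mod_mult2_eq' power_Suc2 mod_mult2_eq del: power_Suc)
  finally show ?case .
qed (simp add: digits_def)


lemma digits_cong: "(\<And>i. i < n \<Longrightarrow> f i = g i) \<Longrightarrow> digits K n f = digits K n g"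
  by (simp add: digits_def)

lemma digits_mod:
  assumes "\<And>i. f i < K" "m \<le> n"
  shows "digits K n f mod K ^ m = digits K m f"
proof -
  have "K > 0" using assms(1)[of 0] by simp
  from digits_digit[OF this, of m "digits K n f"]
  have "digits K n f mod K ^ m = digits K m (digit K (digits K n f))" by simp
  also have "\<dots> = digits K m f" using assms by (intro digits_cong digit_digits) auto
  finally show ?thesis .
qed

lemma set_decode_less: "i \<in> set_decode x \<Longrightarrow> i < x"
proof -
  assume "i \<in> set_decode x"
  then have "odd (x div 2 ^ i)" by (simp add: set_decode_def)
  then have "x div 2 ^ i \<noteq> 0" by (metis even_zero)
  then have "2 ^ i \<le> x" by (metis div_less not_le)
  then show "i < x" by (meson less_exp less_le_trans)
qed

lemma comp_card_set_decode [comp_intros]: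
  assumes "computable_from A f" shows "computable_from A (\<lambda>x. card (set_decode (f x)))"
proof -
  have "rec_nat 0 (\<lambda>i a. a + of_bool (i \<in> set_decode x)) k = card (set_decode x \<inter> {..<k})" for x k
  proof (induction k)
    case (Suc k)
    have "set_decode x \<inter> {..<Suc k} = (if k \<in> set_decode x then insert k (set_decode x \<inter> {..<k}) else set_decode x \<inter> {..<k})"
      by (auto simp: less_Suc_eq)
    with Suc show ?case by simp
  qed simp
  moreover have "set_decode x \<inter> {..<x} = set_decode x" for x using set_decode_less by auto
  moreover have "computable_from A (\<lambda>x. rec_nat 0 (\<lambda>i a. a + of_bool (i \<in> set_decode x)) x)"
    by (intro comp_intros)
  ultimately have "computable_from A (\<lambda>x. card (set_decode x))" by simp
  from comp_compose[OF this assms] show ?thesis .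
qed

lemma set_encode_less:
  assumes "X \<subseteq> {..<m}" shows "set_encode X < 2 ^ m"
proof -
  have "set_encode X \<le> (\<Sum>i\<in>{0..<m}. 2 ^ i)"
    unfolding set_encode_def using assms by (intro sum_mono2) auto
  also have "\<dots> < 2 ^ m" by (simp add: sum_power2)
  finally show ?thesis .
qed

lemma dec_finite_set:
  assumes "finite B" "computable_from A f" shows "decidable_from A (\<lambda>x. f x \<in> B)"
proof -
  have "decidable_from A (\<lambda>x. \<exists>b\<in>B. f x = b)"
    by (rule dec_fin_bex[OF assms(1)]) (intro comp_intros assms(2))
  then show ?thesis by simp
qed


section \<open>Oracles\<close>

definition reducible :: "nat set \<Rightarrow> nat set \<Rightarrow> bool" (infix "\<sqsubseteq>" 50) where
  "X \<sqsubseteq> A \<longleftrightarrow> decidable_from A (\<lambda>x. x \<in> X)"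

lemma reducible_refl: "A \<sqsubseteq> A"
  unfolding reducible_def by (rule dec_Query)

text \<open>A program for the characteristic function of \<open>X\<close> is substituted for
  \<open>Query\<close>. The induction needs equality of partial functions, because subprograms of a
  total program may diverge.\<close>

lemma comp_reducible:
  assumes "computable_from X f" "X \<sqsubseteq> A" shows "computable_from A f"
proof -
  obtain q where q: "\<forall>x. run q A x = Some (of_bool (x \<in> X))"
    using assms(2) unfolding reducible_def decidable_from_def computable_from_def by blast
  have "\<exists>e'. run e' A = run e X" for e
  proof (induction e)
    case Query then show ?case using q by (intro exI[of _ q]) auto
  next
    case Zero show ?case by (rule exI[of _ Zero]) simp
  next
    case Succ show ?case by (rule exI[of _ Succ]) simp
  next
    case Fst show ?case by (rule exI[of _ Fst]) simp
  next
    case Snd show ?case by (rule exI[of _ Snd]) simp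
  next
    case (Pair e1 e2)
    then obtain a b where "run a A = run e1 X" "run b A = run e2 X" by blast
    then show ?case by (intro exI[of _ "functional.Pair a b"]) simp
  next
    case (Comp e1 e2)
    then obtain a b where "run a A = run e1 X" "run b A = run e2 X" by blast
    then show ?case by (intro exI[of _ "Comp a b"]) simp
  next
    case (Prec e1 e2)
    then obtain a b where "run a A = run e1 X" "run b A = run e2 X" by blast
    then show ?case by (intro exI[of _ "Prec a b"]) simp
  next
    case (Mu e)
    then obtain a where a: "run a A = run e X" by blast
    show ?case by (rule exI[of _ "Mu a"]) (simp only: run.simps a)
  qed
  then show ?thesis using assms(1) unfolding computable_from_def by metis
qed

lemma dec_reducible: "decidable_from X P \<Longrightarrow> X \<sqsubseteq> A \<Longrightarrow> decidable_from A P"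
  unfolding decidable_from_def by (rule comp_reducible)

lemma reducible_trans: "X \<sqsubseteq> Y \<Longrightarrow> Y \<sqsubseteq> Z \<Longrightarrow> X \<sqsubseteq> Z"
  unfolding reducible_def[of X] by (rule dec_reducible)

lemma mem_join: "z \<in> join X Y \<longleftrightarrow> (if odd z then z div 2 \<in> Y else z div 2 \<in> X)"
proof (cases "odd z")
  case True
  then obtain b where "z = 2 * b + 1" by (elim oddE)
  then show ?thesis unfolding join_def by auto presburger
next
  case False
  then obtain b where "z = 2 * b" by auto
  then show ?thesis unfolding join_def by auto presburger
qed

lemma reducible_join1: "X \<sqsubseteq> join X Y"
proof -
  have "decidable_from (join X Y) (\<lambda>x. 2 * x \<in> join X Y)"
    by (intro dec_compose[OF dec_Query] comp_intros)
  then show ?thesis unfolding reducible_def mem_join by simp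
qed

lemma reducible_join2: "Y \<sqsubseteq> join X Y"
proof -
  have "decidable_from (join X Y) (\<lambda>x. 2 * x + 1 \<in> join X Y)"
    by (intro dec_compose[OF dec_Query] comp_intros)
  then show ?thesis unfolding reducible_def mem_join by simp
qed

lemma join_reducible:
  assumes "X \<sqsubseteq> A" "Y \<sqsubseteq> A" shows "join X Y \<sqsubseteq> A"
proof -
  have "computable_from A (\<lambda>z. z div 2)" by (intro comp_intros)
  with assms have "decidable_from A (\<lambda>z. z div 2 \<in> X)" "decidable_from A (\<lambda>z. z div 2 \<in> Y)"
    using dec_compose[of A "\<lambda>x. x \<in> X"] dec_compose[of A "\<lambda>x. x \<in> Y"] unfolding reducible_def
    by auto
  then show ?thesis
    unfolding reducible_def mem_join by (intro comp_intros)
qed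

lemma computes_reducible:
  "computes_bounded_enumeration X S \<Longrightarrow> X \<sqsubseteq> A \<Longrightarrow> computes_bounded_enumeration A S"
  unfolding computes_bounded_enumeration_def using comp_reducible by blast

section \<open>Use of a computation and certificates of convergence\<close>

instance functional :: countable by countable_datatype

text \<open>A convergent computation consults the oracle only finitely often. This is what lets a
  finite part of a solution settle a value.\<close>

lemma run_use:
  assumes "run e X n = Some y"
  shows "\<exists>u. \<forall>Y. (\<forall>z<u. z \<in> X \<longleftrightarrow> z \<in> Y) \<longrightarrow> run e Y n = Some y"
  using assms
proof (induction e arbitrary: n y)
  case Query
  then show ?case by (intro exI[of _ "Suc n"]) auto
next
  case (Pair e1 e2)
  from Pair.prems obtain a b where ab: "run e1 X n = Some a" "run e2 X n = Some b" "y = prod_encode (a, b)"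
    by (auto simp: bind_eq_Some_conv)
  from Pair.IH(1)[OF ab(1)] Pair.IH(2)[OF ab(2)] obtain u v where
    "\<forall>Y. (\<forall>z<u. z \<in> X \<longleftrightarrow> z \<in> Y) \<longrightarrow> run e1 Y n = Some a"
    "\<forall>Y. (\<forall>z<v. z \<in> X \<longleftrightarrow> z \<in> Y) \<longrightarrow> run e2 Y n = Some b" by blast
  with ab(3) show ?case by (intro exI[of _ "max u v"]) simp
next
  case (Comp e1 e2)
  from Comp.prems obtain a where ab: "run e2 X n = Some a" "run e1 X a = Some y"
    by (auto simp: bind_eq_Some_conv)
  from Comp.IH(1)[OF ab(2)] Comp.IH(2)[OF ab(1)] obtain u v where
    "\<forall>Y. (\<forall>z<u. z \<in> X \<longleftrightarrow> z \<in> Y) \<longrightarrow> run e1 Y a = Some y"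
    "\<forall>Y. (\<forall>z<v. z \<in> X \<longleftrightarrow> z \<in> Y) \<longrightarrow> run e2 Y n = Some a" by blast
  then show ?case by (intro exI[of _ "max u v"]) simp
next
  case (Prec e1 e2)
  let ?r = "\<lambda>Y x. rec_nat (run e1 Y x) (\<lambda>m r. Option.bind r (\<lambda>v. run e2 Y (prod_encode (x, prod_encode (m, v)))))"
  have "\<exists>u. \<forall>Y. (\<forall>z<u. z \<in> X \<longleftrightarrow> z \<in> Y) \<longrightarrow> ?r Y x k = Some y" if "?r X x k = Some y" for x k y
    using that
  proof (induction k arbitrary: y)
    case 0
    then show ?case using Prec.IH(1) by simp
  next
    case (Suc k)
    from Suc.prems obtain v where v: "?r X x k = Some v"
      "run e2 X (prod_encode (x, prod_encode (k, v))) = Some y" by (auto simp: bind_eq_Some_conv)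
    from Suc.IH[OF v(1)] Prec.IH(2)[OF v(2)] obtain u w where
      "\<forall>Y. (\<forall>z<u. z \<in> X \<longleftrightarrow> z \<in> Y) \<longrightarrow> ?r Y x k = Some v"
      "\<forall>Y. (\<forall>z<w. z \<in> X \<longleftrightarrow> z \<in> Y) \<longrightarrow> run e2 Y (prod_encode (x, prod_encode (k, v))) = Some y"
      by blast
    then show ?case by (intro exI[of _ "max u w"]) simp
  qed
  then show ?case using Prec.prems by simp
next
  case (Mu e)
  let ?f = "\<lambda>Y m. run e Y (prod_encode (n, m))"
  from Mu.prems have ex: "\<exists>m. ?f X m = Some 0 \<and> (\<forall>i<m. ?f X i \<noteq> None)"
    and y: "y = (LEAST m. ?f X m = Some 0)" by (auto split: if_splits)
  then have y0: "?f X y = Some 0" by (metis (mono_tags, lifting) LeastI)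
  have ylt: "\<forall>i<y. ?f X i \<noteq> Some 0" using not_less_Least y by blast
  from ex obtain m where m: "?f X m = Some 0" "\<forall>i<m. ?f X i \<noteq> None" by blast
  \<comment> \<open>\<open>m\<close> witnesses convergence and \<open>y\<close> is the least zero,
    so all values up to \<open>y\<close> are defined; the bound is the maximum of their
    uses.\<close>
  have "y \<le> m" using m(1) y by (simp add: Least_le)
  with m(2) have "\<forall>i<y. \<exists>v. ?f X i = Some (Suc v)"
    using ylt by (metis not0_implies_Suc not_None_eq order_less_le_trans)
  with y0 have "\<forall>i\<le>y. \<exists>v. ?f X i = Some v" by (metis le_neq_implies_less)
  then have "\<forall>i\<in>{..y}. \<exists>u. \<forall>Y. (\<forall>z<u. z \<in> X \<longleftrightarrow> z \<in> Y) \<longrightarrow> ?f Y i = ?f X i"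
    using Mu.IH by (metis atMost_iff)
  then obtain u where u: "\<And>i Y. i \<le> y \<Longrightarrow> (\<forall>z<u i. z \<in> X \<longleftrightarrow> z \<in> Y) \<Longrightarrow> ?f Y i = ?f X i"
    by (metis atMost_iff)
  show ?case
  proof (intro exI[of _ "Max (u ` {..y})"] allI impI)
    fix Y assume Y: "\<forall>z<Max (u ` {..y}). z \<in> X \<longleftrightarrow> z \<in> Y"
    have eq: "?f Y i = ?f X i" if "i \<le> y" for i
    proof (rule u[OF that])
      have "u i \<le> Max (u ` {..y})" using that by simp
      then show "\<forall>z<u i. z \<in> X \<longleftrightarrow> z \<in> Y" using Y by auto
    qed
    have "(LEAST m. ?f Y m = Some 0) = y"
      by (rule Least_equality) (use eq y0 ylt in \<open>auto simp: not_less[symmetric]\<close>)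
    moreover have "?f Y y = Some 0 \<and> (\<forall>i<y. ?f Y i \<noteq> None)"
      using eq y0 m(2) \<open>y \<le> m\<close> by auto
    ultimately show "run (Mu e) Y n = Some y" by auto
  qed
qed auto

text \<open>
  The last argument of \<open>F\<close> is a certificate of convergence: for \<^const>\<open>Prec\<close> and \<^const>\<open>Mu\<close> it
  contains one certificate for each value that enters the computation.
\<close>

lemma run_certificate:
  assumes q: "decidable_from A (\<lambda>p. q (p1 p) (p2 p))"
  shows "\<exists>F. computable_from A (\<lambda>p. F (p1 p) (p1 (p2 p)) (p2 (p2 p))) \<and>
    (\<forall>w n y. run e {z. q w z} n = Some y \<longleftrightarrow> (\<exists>s. F w n s = Suc y))"
proof (induction e)
  case Query
  \<comment> \<open>The value 0 of \<open>F\<close> rejects a certificate and \<open>Suc y\<close>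
    confirms the output \<open>y\<close>. Oracle questions need no certificate, since the oracle is
    decidable uniformly in \<open>w\<close>.\<close>
  show ?case by (intro exI[of _ "\<lambda>w n s. Suc (of_bool (q w n))"] conjI comp_intros dec_compose2[OF q]) auto
next
  case Zero
  show ?case by (intro exI[of _ "\<lambda>w n s. Suc 0"] conjI comp_intros) auto
next
  case Succ
  show ?case by (intro exI[of _ "\<lambda>w n s. Suc (Suc n)"] conjI comp_intros) auto
next
  case Fst
  show ?case by (intro exI[of _ "\<lambda>w n s. Suc (p1 n)"] conjI comp_intros) auto
next
  case Snd
  show ?case by (intro exI[of _ "\<lambda>w n s. Suc (p2 n)"] conjI comp_intros) auto
next
  case (Pair e1 e2)
  then obtain F G where F: "computable_from A (\<lambda>p. F (p1 p) (p1 (p2 p)) (p2 (p2 p)))"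
    "\<forall>w n y. run e1 {z. q w z} n = Some y \<longleftrightarrow> (\<exists>s. F w n s = Suc y)"
    and G: "computable_from A (\<lambda>p. G (p1 p) (p1 (p2 p)) (p2 (p2 p)))"
    "\<forall>w n y. run e2 {z. q w z} n = Some y \<longleftrightarrow> (\<exists>s. G w n s = Suc y)" by auto
  let ?H = "\<lambda>w n s. if F w n (p1 s) = 0 \<or> G w n (p2 s) = 0 then 0
    else Suc (prod_encode (F w n (p1 s) - 1, G w n (p2 s) - 1))"
  have "computable_from A (\<lambda>p. F (p1 p) (p1 (p2 p)) (p1 (p2 (p2 p))))"
    "computable_from A (\<lambda>p. G (p1 p) (p1 (p2 p)) (p2 (p2 (p2 p))))"
    using comp_compose[OF F(1), of "\<lambda>p. prod_encode (p1 p, prod_encode (p1 (p2 p), p1 (p2 (p2 p))))"]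
      comp_compose[OF G(1), of "\<lambda>p. prod_encode (p1 p, prod_encode (p1 (p2 p), p2 (p2 (p2 p))))"]
    by (simp_all add: comp_intros)
  then have "computable_from A (\<lambda>p. ?H (p1 p) (p1 (p2 p)) (p2 (p2 p)))"
    by (intro comp_intros)
  moreover have "run (functional.Pair e1 e2) {z. q w z} n = Some y \<longleftrightarrow> (\<exists>s. ?H w n s = Suc y)" for w n y
  proof
    assume "run (functional.Pair e1 e2) {z. q w z} n = Some y"
    then obtain a b where ab: "run e1 {z. q w z} n = Some a" "run e2 {z. q w z} n = Some b"
      "y = prod_encode (a, b)" by (auto simp: bind_eq_Some_conv)
    then obtain s t where "F w n s = Suc a" "G w n t = Suc b" using F G by blast
    then show "\<exists>s. ?H w n s = Suc y" using ab(3) by (intro exI[of _ "prod_encode (s, t)"]) simp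
  next
    assume "\<exists>s. ?H w n s = Suc y"
    then obtain s where s: "F w n (p1 s) \<noteq> 0" "G w n (p2 s) \<noteq> 0"
      "y = prod_encode (F w n (p1 s) - 1, G w n (p2 s) - 1)" by (auto split: if_splits)
    then have "run e1 {z. q w z} n = Some (F w n (p1 s) - 1)" "run e2 {z. q w z} n = Some (G w n (p2 s) - 1)"
      using F(2) G(2) by (metis Suc_diff_1 neq0_conv)+
    then show "run (functional.Pair e1 e2) {z. q w z} n = Some y" using s(3) by simp
  qed
  ultimately show ?case by (intro exI[of _ ?H]) blast
next
  case (Comp e1 e2)
  then obtain F G where F: "computable_from A (\<lambda>p. F (p1 p) (p1 (p2 p)) (p2 (p2 p)))"
    "\<forall>w n y. run e1 {z. q w z} n = Some y \<longleftrightarrow> (\<exists>s. F w n s = Suc y)"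
    and G: "computable_from A (\<lambda>p. G (p1 p) (p1 (p2 p)) (p2 (p2 p)))"
    "\<forall>w n y. run e2 {z. q w z} n = Some y \<longleftrightarrow> (\<exists>s. G w n s = Suc y)" by auto
  let ?H = "\<lambda>w n s. if G w n (p1 s) = 0 then 0 else F w (G w n (p1 s) - 1) (p2 s)"
  have 1: "computable_from A (\<lambda>p. G (p1 p) (p1 (p2 p)) (p1 (p2 (p2 p))))"
    using comp_compose[OF G(1), of "\<lambda>p. prod_encode (p1 p, prod_encode (p1 (p2 p), p1 (p2 (p2 p))))"]
    by (simp add: comp_intros)
  have "computable_from A (\<lambda>p. F (p1 p) (G (p1 p) (p1 (p2 p)) (p1 (p2 (p2 p))) - 1) (p2 (p2 (p2 p))))"
    using comp_compose[OF F(1), of "\<lambda>p. prod_encode (p1 p, prod_encode (G (p1 p) (p1 (p2 p)) (p1 (p2 (p2 p))) - 1, p2 (p2 (p2 p))))"]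
    by (simp add: comp_intros 1)
  with 1 have "computable_from A (\<lambda>p. ?H (p1 p) (p1 (p2 p)) (p2 (p2 p)))"
    by (intro comp_intros)
  moreover have "run (Comp e1 e2) {z. q w z} n = Some y \<longleftrightarrow> (\<exists>s. ?H w n s = Suc y)" for w n y
  proof
    assume "run (Comp e1 e2) {z. q w z} n = Some y"
    then obtain a where a: "run e2 {z. q w z} n = Some a" "run e1 {z. q w z} a = Some y"
      by (auto simp: bind_eq_Some_conv)
    then obtain s t where "F w a s = Suc y" "G w n t = Suc a" using F G by blast
    then show "\<exists>s. ?H w n s = Suc y" by (intro exI[of _ "prod_encode (t, s)"]) simp
  next
    assume "\<exists>s. ?H w n s = Suc y"
    then obtain s where s: "G w n (p1 s) \<noteq> 0" "F w (G w n (p1 s) - 1) (p2 s) = Suc y"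
      by (auto split: if_splits)
    then have "run e2 {z. q w z} n = Some (G w n (p1 s) - 1)" "run e1 {z. q w z} (G w n (p1 s) - 1) = Some y"
      using F(2) G(2) by (metis Suc_diff_1 neq0_conv)+
    then show "run (Comp e1 e2) {z. q w z} n = Some y" by simp
  qed
  ultimately show ?case by (intro exI[of _ ?H]) blast
next
  case (Prec e1 e2)
  then obtain F G where F: "computable_from A (\<lambda>p. F (p1 p) (p1 (p2 p)) (p2 (p2 p)))"
    "\<forall>w n y. run e1 {z. q w z} n = Some y \<longleftrightarrow> (\<exists>s. F w n s = Suc y)"
    and G: "computable_from A (\<lambda>p. G (p1 p) (p1 (p2 p)) (p2 (p2 p)))"
    "\<forall>w n y. run e2 {z. q w z} n = Some y \<longleftrightarrow> (\<exists>s. G w n s = Suc y)" by auto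
  let ?h = "\<lambda>w x s. rec_nat (F w x (entry s 0))
    (\<lambda>m r. if r = 0 then 0 else G w (prod_encode (x, prod_encode (m, r - 1))) (entry s (Suc m)))"
  let ?H = "\<lambda>w n s. ?h w (p1 n) s (p2 n)"
  have 1: "computable_from A (\<lambda>p. F (p1 p) (p1 (p1 (p2 p))) (entry (p2 (p2 p)) 0))"
    using comp_compose[OF F(1), of "\<lambda>p. prod_encode (p1 p, prod_encode (p1 (p1 (p2 p)), entry (p2 (p2 p)) 0))"]
    by (simp add: comp_intros)
  have 2: "computable_from A (\<lambda>t. G (p1 (p1 t)) (prod_encode (p1 (p1 (p2 (p1 t))), prod_encode (p1 (p2 t), p2 (p2 t) - 1)))
      (entry (p2 (p2 (p1 t))) (Suc (p1 (p2 t)))))"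
    using comp_compose[OF G(1), of "\<lambda>t. prod_encode (p1 (p1 t), prod_encode (prod_encode (p1 (p1 (p2 (p1 t))), prod_encode (p1 (p2 t), p2 (p2 t) - 1)),
      entry (p2 (p2 (p1 t))) (Suc (p1 (p2 t)))))"]
    by (simp add: comp_intros)
  have "computable_from A (\<lambda>p. ?H (p1 p) (p1 (p2 p)) (p2 (p2 p)))"
    by (intro 1 2 comp_intros)
  moreover have "run (Prec e1 e2) {z. q w z} n = Some y \<longleftrightarrow> (\<exists>s. ?H w n s = Suc y)" for w n y
  proof -
    let ?r = "\<lambda>x. rec_nat (run e1 {z. q w z} x)
      (\<lambda>m r. Option.bind r (\<lambda>v. run e2 {z. q w z} (prod_encode (x, prod_encode (m, v)))))"
    have a: "?r x k = Some y" if "?h w x s k = Suc y" for x s k y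
      using that
    proof (induction k arbitrary: y)
      case 0
      then show ?case using F(2) by auto
    next
      case (Suc k)
      then obtain v where v: "?h w x s k = Suc v"
        "G w (prod_encode (x, prod_encode (k, v))) (entry s (Suc k)) = Suc y"
        by (cases "?h w x s k") auto
      from Suc.IH[OF v(1)] have "?r x k = Some v" .
      then show ?case using v(2) G(2) by auto
    qed
    \<comment> \<open>The certificates are first collected in a function, which is easily prolonged
      at \<open>Suc k\<close>; a code \<open>s\<close> with these entries is chosen only at the
      end.\<close>
    have b: "\<exists>f. \<forall>s. (\<forall>i\<le>k. entry s i = f i) \<longrightarrow> ?h w x s k = Suc y" if "?r x k = Some y" for x k y
      using that
    proof (induction k arbitrary: y)
      case 0
      then obtain c where "F w x c = Suc y" using F(2) by auto
      then show ?case by (intro exI[of _ "\<lambda>_. c"]) auto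
    next
      case (Suc k)
      from Suc.prems obtain v where v: "?r x k = Some v"
        "run e2 {z. q w z} (prod_encode (x, prod_encode (k, v))) = Some y" by (auto simp: bind_eq_Some_conv)
      then obtain c where c: "G w (prod_encode (x, prod_encode (k, v))) c = Suc y" using G(2) by blast
      from Suc.IH[OF v(1)] obtain f where f: "\<forall>s. (\<forall>i\<le>k. entry s i = f i) \<longrightarrow> ?h w x s k = Suc v" by blast
      show ?case
      proof (intro exI[of _ "f(Suc k := c)"] allI impI)
        fix s assume s: "\<forall>i\<le>Suc k. entry s i = (f(Suc k := c)) i"
        then have "\<forall>i\<le>k. entry s i = f i" by auto
        then have "?h w x s k = Suc v" using f by blast
        then show "?h w x s (Suc k) = Suc y" using c s by simp
      qed
    qed
    show ?thesis
    proof
      assume "run (Prec e1 e2) {z. q w z} n = Some y"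
      then have "?r (p1 n) (p2 n) = Some y" by simp
      from b[OF this] obtain f where f: "\<forall>s. (\<forall>i\<le>p2 n. entry s i = f i) \<longrightarrow> ?h w (p1 n) s (p2 n) = Suc y" by blast
      obtain s where "\<forall>i<Suc (p2 n). entry s i = f i" using ex_entry by blast
      then show "\<exists>s. ?H w n s = Suc y" using f by (intro exI[of _ s]) (simp add: less_Suc_eq_le)
    qed (use a in auto)
  qed
  ultimately show ?case by (intro exI[of _ ?H]) blast
next
  case (Mu e)
  then obtain F where F: "computable_from A (\<lambda>p. F (p1 p) (p1 (p2 p)) (p2 (p2 p)))"
    "\<forall>w n y. run e {z. q w z} n = Some y \<longleftrightarrow> (\<exists>s. F w n s = Suc y)" by auto
  let ?g = "\<lambda>w n s i. F w (prod_encode (n, i)) (entry (p2 s) i)"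
  \<comment> \<open>Because of the shift by one, \<open>= 1\<close> confirms the output 0 and
    \<open>1 <\<close> confirms a nonzero output.\<close>
  let ?H = "\<lambda>w n s. if ?g w n s (p1 s) = 1 \<and> (\<forall>i<p1 s. 1 < ?g w n s i) then Suc (p1 s) else 0"
  have 1: "computable_from A (\<lambda>p. F (p1 p) (prod_encode (p1 (p2 p), p1 (p2 (p2 p)))) (entry (p2 (p2 (p2 p))) (p1 (p2 (p2 p)))))"
    using comp_compose[OF F(1), of "\<lambda>p. prod_encode (p1 p, prod_encode (prod_encode (p1 (p2 p), p1 (p2 (p2 p))), entry (p2 (p2 (p2 p))) (p1 (p2 (p2 p)))))"]
    by (simp add: comp_intros)
  have 2: "computable_from A (\<lambda>t. F (p1 (p1 t)) (prod_encode (p1 (p2 (p1 t)), p2 t)) (entry (p2 (p2 (p2 (p1 t)))) (p2 t)))"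
    using comp_compose[OF F(1), of "\<lambda>t. prod_encode (p1 (p1 t), prod_encode (prod_encode (p1 (p2 (p1 t)), p2 t), entry (p2 (p2 (p2 (p1 t)))) (p2 t)))"]
    by (simp add: comp_intros)
  have "computable_from A (\<lambda>p. ?H (p1 p) (p1 (p2 p)) (p2 (p2 p)))"
    by (intro 1 2 comp_intros)
  moreover have "run (Mu e) {z. q w z} n = Some y \<longleftrightarrow> (\<exists>s. ?H w n s = Suc y)" for w n y
  proof -
    let ?f = "\<lambda>m. run e {z. q w z} (prod_encode (n, m))"
    show ?thesis
    proof
      assume "run (Mu e) {z. q w z} n = Some y"
      then have ex: "\<exists>m. ?f m = Some 0 \<and> (\<forall>i<m. ?f i \<noteq> None)"
        and y: "y = (LEAST m. ?f m = Some 0)" by (auto split: if_splits)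
      then have y0: "?f y = Some 0" by (metis (mono_tags, lifting) LeastI)
      have ylt: "\<forall>i<y. ?f i \<noteq> Some 0" using not_less_Least y by blast
      from ex obtain m where m: "?f m = Some 0" "\<forall>i<m. ?f i \<noteq> None" by blast
      have "y \<le> m" using m(1) y by (simp add: Least_le)
      with m(2) have "\<forall>i<y. \<exists>v. ?f i = Some (Suc v)"
        using ylt by (metis not0_implies_Suc not_None_eq order_less_le_trans)
      then have "\<forall>i<y. \<exists>s v. F w (prod_encode (n, i)) s = Suc (Suc v)" using F(2) by blast
      then have "\<forall>i<y. \<exists>s. F w (prod_encode (n, i)) s > 1" by (metis less_Suc_eq_0_disj One_nat_def Suc_less_eq)
      then obtain c where c: "\<And>i. i < y \<Longrightarrow> F w (prod_encode (n, i)) (c i) > 1" by metis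
      obtain d where d: "F w (prod_encode (n, y)) d = 1" using F(2) y0 by auto
      obtain s where s: "\<forall>i<Suc y. entry s i = (c(y := d)) i" using ex_entry by blast
      then have "?H w n (prod_encode (y, s)) = Suc y" using c d by auto
      then show "\<exists>s. ?H w n s = Suc y" by blast
    next
      assume "\<exists>s. ?H w n s = Suc y"
      then obtain s where s: "?g w n s y = 1" "\<forall>i<y. 1 < ?g w n s i" "p1 s = y"
        by (auto split: if_splits)
      have y: "?f y = Some 0" using F(2) s(1) by (metis One_nat_def)
      have lt: "\<exists>v. ?f i = Some (Suc v)" if "i < y" for i
      proof -
        have "1 < ?g w n s i" by (rule s(2)[rule_format, OF that])
        then have "?g w n s i = Suc (Suc (?g w n s i - 2))" by simp
        with F(2) show ?thesis by blast
      qed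
      have "(LEAST m. ?f m = Some 0) = y"
      proof (rule Least_equality)
        show "?f y = Some 0" by (rule y)
        fix m assume "?f m = Some 0"
        then show "y \<le> m" using lt[of m] by (cases "m < y") auto
      qed
      moreover have "?f y = Some 0 \<and> (\<forall>i<y. ?f i \<noteq> None)" using y lt by auto
      ultimately show "run (Mu e) {z. q w z} n = Some y" by auto
    qed
  qed
  ultimately show ?case by (intro exI[of _ ?H]) blast
qed


section \<open>Strings and embeddings\<close>

abbreviation str :: "nat \<Rightarrow> bool list" where "str \<equiv> inv string_code"

lemma str_code [simp]: "str (string_code s) = s"
  using bij_string_code by (simp add: bij_is_inj)

lemma code_str [simp]: "string_code (str x) = x"
  using bij_string_code by (simp add: bij_is_surj surj_f_inv_f)

lemma code_eq_iff [simp]: "string_code s = string_code t \<longleftrightarrow> s = t"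
  by (metis str_code)

lemma code_append: "string_code (s @ t) = string_code s + 2 ^ length s * string_code t"
  by (induction s) (auto simp: algebra_simps)

text \<open>The strings of length \<open>m\<close> have exactly the codes from
  \<open>2 ^ m - 1\<close> to \<open>2 * 2 ^ m - 2\<close>, which turns comparisons of lengths into
  comparisons of codes.\<close>

lemma code_bounds: "2 ^ length s \<le> string_code s + 1" "string_code s + 1 < 2 * 2 ^ length s"
  by (induction s) auto

lemma length_less_iff: "length s < m \<longleftrightarrow> string_code s < 2 ^ m - 1"
proof
  assume "length s < m"
  then have "2 * 2 ^ length s \<le> (2 ^ m :: nat)" by (metis Suc_leI one_le_numeral power_Suc power_increasing)
  then show "string_code s < 2 ^ m - 1" using code_bounds(2)[of s] by linarith
next
  assume "string_code s < 2 ^ m - 1"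
  then have "(2::nat) ^ length s < 2 ^ m" using code_bounds(1)[of s] by linarith
  then show "length s < m" by simp
qed

lemma length_le_code: "length s \<le> string_code s"
  by (induction s) auto

lemma finite_length_eq: "finite {s :: bool list. length s = m}"
  using finite_lists_length_eq[of "UNIV :: bool set" m] by simp

text \<open>Once the least code of level \<open>m\<close> is subtracted, the first \<open>m\<close>
  bits form the remainder and the code of the rest is the quotient, so cutting a string at level
  \<open>m\<close> is plain arithmetic.\<close>

lemma code_length_eq:
  assumes "length t = m"
  shows "(string_code (t @ x) - (2 ^ m - 1)) mod 2 ^ m = string_code t - (2 ^ m - 1)"
    and "(string_code (t @ x) - (2 ^ m - 1)) div 2 ^ m = string_code x"
proof -
  have *: "string_code (t @ x) - (2 ^ m - 1) = (string_code t - (2 ^ m - 1)) + 2 ^ m * string_code x"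
    using code_bounds(1)[of t] assms by (simp add: code_append)
  have "string_code t - (2 ^ m - 1) < 2 ^ m" using code_bounds(2)[of t] assms by simp
  then show "(string_code (t @ x) - (2 ^ m - 1)) mod 2 ^ m = string_code t - (2 ^ m - 1)"
    "(string_code (t @ x) - (2 ^ m - 1)) div 2 ^ m = string_code x"
    unfolding * by simp_all
qed

definition level_string :: "nat \<Rightarrow> nat \<Rightarrow> bool list" where
  "level_string m i = str (i + (2 ^ m - 1))"

lemma length_level_string:
  assumes "i < 2 ^ m" shows "length (level_string m i) = m"
proof -
  have "\<not> length (level_string m i) < m" "length (level_string m i) < Suc m"
    unfolding length_less_iff level_string_def using assms by auto
  then show ?thesis by simp
qed

lemma level_string_code: "length t = m \<Longrightarrow> level_string m (string_code t - (2 ^ m - 1)) = t"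
  unfolding level_string_def using code_bounds(1)[of t] by simp

lemma comp_length [comp_intros]:
  assumes "computable_from A f" shows "computable_from A (\<lambda>x. length (str (f x)))"
proof -
  have "computable_from A (\<lambda>x. LEAST m. x < 2 ^ Suc m - 1)"
  proof (intro comp_intros)
    show "\<exists>m. x < 2 ^ Suc m - 1" for x :: nat
      using length_less_iff[of "str x" "Suc (length (str x))"] by auto
  qed
  moreover have "(LEAST m. x < 2 ^ Suc m - 1) = length (str x)" for x
  proof (rule Least_equality)
    show "x < 2 ^ Suc (length (str x)) - 1"
      using length_less_iff[of "str x" "Suc (length (str x))"] by simp
    show "length (str x) \<le> m" if "x < 2 ^ Suc m - 1" for m
      using length_less_iff[of "str x" "Suc m"] that by simp
  qed
  ultimately have "computable_from A (\<lambda>x. length (str x))" by simp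
  from comp_compose[OF this assms] show ?thesis .
qed

lemma dec_prefix [comp_intros]:
  assumes "computable_from A f" "computable_from A g"
  shows "decidable_from A (\<lambda>x. prefix (str (f x)) (str (g x)))"
proof -
  \<comment> \<open>\<open>c\<close> is the code of the appended string; it is at most
    \<open>y\<close>, so the search for it is bounded.\<close>
  have "prefix (str x) (str y) \<longleftrightarrow> (\<exists>c<Suc y. y = x + 2 ^ length (str x) * c)" for x y :: nat
  proof
    assume "prefix (str x) (str y)"
    then obtain t where "str y = str x @ t" by (auto elim: prefixE)
    then have "y = x + 2 ^ length (str x) * string_code t"
      by (metis code_append code_str)
    moreover from this have "string_code t \<le> y"
      by (metis le_add2 le_trans mult.commute mult_le_mono2 nat_mult_1_right one_le_numeral one_le_power)
    ultimately show "\<exists>c<Suc y. y = x + 2 ^ length (str x) * c" by auto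
  next
    assume "\<exists>c<Suc y. y = x + 2 ^ length (str x) * c"
    then obtain c where "y = x + 2 ^ length (str x) * c" by blast
    then have "string_code (str x @ str c) = y" by (simp add: code_append)
    then have "str y = str x @ str c" by (metis str_code)
    then show "prefix (str x) (str y)" by simp
  qed
  moreover have "decidable_from A (\<lambda>p. \<exists>c<Suc (p2 p). p2 p = p1 p + 2 ^ length (str (p1 p)) * c)"
    by (intro comp_intros)
  ultimately have "decidable_from A (\<lambda>p. prefix (str (p1 p)) (str (p2 p)))" by simp
  from dec_compose2[OF this assms] show ?thesis .
qed

section \<open>Computable embeddings of the binary tree\<close>

definition string_computable :: "nat set \<Rightarrow> (bool list \<Rightarrow> bool list) \<Rightarrow> bool" where
  "string_computable A h \<longleftrightarrow> computable_from A (\<lambda>x. string_code (h (str x)))"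

lemma string_computable_id: "string_computable A (\<lambda>s. s)"
  unfolding string_computable_def by (simp add: comp_id)

lemma string_computable_comp:
  assumes "string_computable A f" "string_computable A g"
  shows "string_computable A (\<lambda>s. f (g s))"
  using comp_compose[of A "\<lambda>x. string_code (f (str x))" "\<lambda>x. string_code (g (str x))"] assms
  unfolding string_computable_def by simp

lemma string_computable_append: "string_computable A (\<lambda>s. t @ s)"
  unfolding string_computable_def code_append code_str by (intro comp_intros)

lemma string_computable_reducible: "string_computable X h \<Longrightarrow> X \<sqsubseteq> A \<Longrightarrow> string_computable A h"
  unfolding string_computable_def by (rule comp_reducible)

text \<open>Reservoirs are thinned separately while the finite part is kept or prescribed; all such
  changes of a condition are instances of this map.\<close>

definition glue :: "nat \<Rightarrow> (bool list \<Rightarrow> bool list) \<Rightarrow> (bool list \<Rightarrow> bool list \<Rightarrow> bool list) \<Rightarrow> bool list \<Rightarrow> bool list" where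
  "glue m j F s = (if length s < m then j s else F (take m s) (drop m s))"

text \<open>Neither \<open>j\<close> nor the dependence of \<open>F\<close> on \<open>t\<close> has
  to be computable: only finitely many strings and finitely many maps are involved.\<close>

lemma string_computable_glue:
  assumes "\<And>t. length t = m \<Longrightarrow> string_computable A (F t)"
  shows "string_computable A (glue m j F)"
proof -
  let ?M = "2 ^ m - 1 :: nat"
  let ?r = "\<lambda>x. (x - ?M) mod 2 ^ m" and ?d = "\<lambda>x. (x - ?M) div 2 ^ m"
  have r: "computable_from A ?r" and d: "computable_from A ?d" by (intro comp_intros)+
  let ?f = "\<lambda>x. if ?r x < 2 ^ m then string_code (F (level_string m (?r x)) (str (?d x))) else 0"
  have f: "computable_from A ?f"
    by (rule comp_cases[OF _ d r, where f = "\<lambda>i x. string_code (F (level_string m i) (str x))"])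
      (use assms length_level_string in \<open>auto simp: string_computable_def\<close>)
  have j: "computable_from A (\<lambda>x. if x < ?M then string_code (j (str x)) else 0)"
    by (rule comp_cases[where f = "\<lambda>i x. string_code (j (str i))", OF comp_const comp_id comp_id])
  have "decidable_from A (\<lambda>x. x < ?M)" by (intro comp_intros)
  then have "computable_from A (\<lambda>x. if x < ?M then (if x < ?M then string_code (j (str x)) else 0) else ?f x)"
    by (rule comp_if[OF _ j f])
  moreover have "(if x < ?M then (if x < ?M then string_code (j (str x)) else 0) else ?f x)
    = string_code (glue m j F (str x))" for x
  proof (cases "x < ?M")
    case True
    then show ?thesis using length_less_iff[of "str x" m] by (simp add: glue_def)
  next
    case False
    then have len: "\<not> length (str x) < m" using length_less_iff[of "str x" m] by simp
    then have "string_code (take m (str x) @ drop m (str x)) = x" "length (take m (str x)) = m" by auto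
    then have "?r x = string_code (take m (str x)) - ?M" "?d x = string_code (drop m (str x))"
      using code_length_eq[of "take m (str x)" m "drop m (str x)"] by simp_all
    then have "level_string m (?r x) = take m (str x)" "str (?d x) = drop m (str x)"
      using level_string_code[of "take m (str x)" m] \<open>length (take m (str x)) = m\<close> by auto
    moreover have "?r x < 2 ^ m" by simp
    ultimately show ?thesis using False len by (simp add: glue_def)
  qed
  ultimately show ?thesis unfolding string_computable_def by simp
qed

definition embedding :: "(bool list \<Rightarrow> bool list) \<Rightarrow> bool" where
  "embedding h \<longleftrightarrow> (\<forall>s t. prefix (h s) (h t) \<longleftrightarrow> prefix s t)"

lemma embedding_id: "embedding (\<lambda>s. s)" by (simp add: embedding_def)

lemma embedding_append: "embedding (\<lambda>s. t @ s)" by (simp add: embedding_def)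

lemma embedding_comp: "embedding f \<Longrightarrow> embedding g \<Longrightarrow> embedding (\<lambda>s. f (g s))"
  by (simp add: embedding_def)

lemma embedding_inj: "embedding h \<Longrightarrow> h s = h t \<longleftrightarrow> s = t"
  unfolding embedding_def by (metis prefix_order.eq_iff)

lemma embedding_length:
  assumes "embedding h" shows "length s \<le> length (h s)"
proof (induction s rule: rev_induct)
  case (snoc b s)
  have "prefix (h s) (h (s @ [b]))" "h s \<noteq> h (s @ [b])"
    using assms embedding_inj[OF assms] by (auto simp: embedding_def)
  then have "length (h s) < length (h (s @ [b]))"
    by (simp add: prefix_length_less prefix_order.less_le strict_prefix_def)
  with snoc show ?case by simp
qed simp

lemma perfect_tree_range: "embedding h \<Longrightarrow> perfect_tree (range h)"
  unfolding perfect_tree_def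
  by (rule exI[of _ h]) (auto simp: bij_betw_def inj_on_def embedding_inj embedding_def)

lemma perfect_treeE:
  assumes "perfect_tree T" obtains h where "embedding h" "range h = T"
  using assms unfolding perfect_tree_def embedding_def bij_betw_def by blast

text \<open>Incomparability of sibling images is inherited by everything above them, so the two
  local conditions decide all pairs.\<close>

lemma embeddingI:
  assumes up: "\<And>s b. prefix (h s) (h (s @ [b]))"
    and inc: "\<And>s b. \<not> prefix (h (s @ [b])) (h (s @ [\<not> b]))"
  shows "embedding h"
proof -
  have mono: "prefix (h s) (h (s @ t))" for s t
  proof (induction t rule: rev_induct)
    case (snoc b t)
    then show ?case using up[of "s @ t" b] by (metis append_assoc prefix_order.trans)
  qed simp
  have "\<not> prefix (h s) (h t)" if "\<not> prefix s t" for s t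
  proof
    assume st: "prefix (h s) (h t)"
    show False
    proof (cases "prefix t s")
      case True
      then obtain u where "s = t @ u" by (auto elim: prefixE)
      moreover with that have "u \<noteq> []" by auto
      then obtain b v where "u = b # v" by (cases u) auto
      ultimately have "prefix (h (t @ [b])) (h s)" using mono[of "t @ [b]" v] by simp
      moreover have "prefix (h t) (h (t @ [\<not> b]))" by (rule up)
      ultimately show False using st inc[of t b] by (meson prefix_order.trans)
    next
      case False
      with that have "s \<parallel> t" by auto
      then obtain c b v b' w where "s = c @ b # v" "t = c @ b' # w" "b \<noteq> b'"
        using parallel_decomp by blast
      then have "prefix (h (c @ [b])) (h s)" "prefix (h (c @ [\<not> b])) (h t)"
        using mono[of "c @ [b]" v] mono[of "c @ [b']" w] by auto
      then have "prefix (h (c @ [b])) (h t)" using st by (meson prefix_order.trans)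
      with \<open>prefix (h (c @ [\<not> b])) (h t)\<close> show False
        using inc[of c b] inc[of c "\<not> b"] prefix_same_cases by fastforce
    qed
  qed
  then show ?thesis unfolding embedding_def using mono by (metis prefixE)
qed

lemma embedding_glue:
  assumes short: "\<And>s t. length s < m \<Longrightarrow> length t < m \<Longrightarrow> prefix (j s) (j t) \<longleftrightarrow> prefix s t"
    and up: "\<And>s t x. length s < m \<Longrightarrow> length t = m \<Longrightarrow> prefix (j s) (F t x) \<longleftrightarrow> prefix s t"
    and down: "\<And>s t x. length s < m \<Longrightarrow> length t = m \<Longrightarrow> \<not> prefix (F t x) (j s)"
    and inc: "\<And>t t' x y. length t = m \<Longrightarrow> length t' = m \<Longrightarrow> prefix (F t x) (F t' y) \<Longrightarrow> t = t'"
    and emb: "\<And>t. length t = m \<Longrightarrow> embedding (F t)"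
  shows "embedding (glue m j F)"
  unfolding embedding_def
proof (intro allI)
  fix s t :: "bool list"
  consider "length s < m" "length t < m" | "length s < m" "\<not> length t < m"
    | "\<not> length s < m" "length t < m" | "\<not> length s < m" "\<not> length t < m" by blast
  then show "prefix (glue m j F s) (glue m j F t) \<longleftrightarrow> prefix s t"
  proof cases
    case 1 then show ?thesis using short by (simp add: glue_def)
  next
    case 2
    have "prefix s (take m t) \<longleftrightarrow> prefix s t"
    proof
      assume "prefix s t"
      then show "prefix s (take m t)" using 2
        by (intro prefix_length_prefix[OF _ take_is_prefix]) auto
    qed (metis prefix_order.trans take_is_prefix)
    then show ?thesis using 2 up[of s "take m t"] by (simp add: glue_def)
  next
    case 3
    then have "\<not> prefix s t" by (auto dest: prefix_length_le)
    then show ?thesis using 3 down[of t "take m s"] by (simp add: glue_def)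
  next
    case 4
    show ?thesis
    proof (cases "take m s = take m t")
      case True
      have "prefix s t \<longleftrightarrow> prefix (drop m s) (drop m t)"
        by (metis True append_take_drop_id same_prefix_prefix)
      then show ?thesis using 4 True emb[of "take m t"] by (simp add: glue_def embedding_def)
    next
      case False
      then have "\<not> prefix s t" using 4 by (auto elim: prefixE)
      then show ?thesis using 4 False inc[of "take m s" "take m t"] by (auto simp: glue_def)
    qed
  qed
qed

text \<open>The search is for pairs of incomparable extensions inside \<open>T\<close>, so not all of \<open>T\<close> is reached.\<close>

lemma computable_embedding:
  assumes T: "decidable_from A (\<lambda>x. x \<in> string_code ` T)" and h: "embedding h" "range h = T"
  shows "\<exists>g. embedding g \<and> string_computable A g \<and> range g \<subseteq> T"
proof -
  let ?T = "\<lambda>x. x \<in> string_code ` T"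
  \<comment> \<open>The disjunct \<open>\<not> ?T r\<close> lets the search succeed at once outside
    the tree, which makes it total.\<close>
  let ?R = "\<lambda>r z. \<not> ?T r \<or> ?T (p1 z) \<and> ?T (p2 z) \<and> prefix (str r) (str (p1 z)) \<and> prefix (str r) (str (p2 z))
    \<and> \<not> prefix (str (p1 z)) (str (p2 z)) \<and> \<not> prefix (str (p2 z)) (str (p1 z))"
  have ex: "\<exists>z. ?R r z" for r
  proof (cases "?T r")
    case True
    then obtain s where s: "str r = h s" using h(2) by auto
    show ?thesis
      by (rule exI[of _ "prod_encode (string_code (h (s @ [False])), string_code (h (s @ [True])))"])
        (use h in \<open>auto simp: s embedding_def\<close>)
  qed simp
  define L where "L r = (LEAST z. ?R r z)" for r
  have L: "?R r (L r)" for r unfolding L_def by (rule LeastI_ex[OF ex])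
  have "decidable_from A (\<lambda>p. ?R (p1 p) (p2 p))"
    by (intro comp_intros dec_compose[OF T])
  then have L_comp: "computable_from A L" unfolding L_def using ex by (rule comp_Least)
  define c where "c r b = (if b then p2 (L r) else p1 (L r))" for r b
  define r0 where "r0 = string_code (h [])"
  define f where "f = foldl c r0"
  have fT: "?T (f s)" for s
  proof (induction s rule: rev_induct)
    case Nil then show ?case using h(2) by (auto simp: f_def r0_def)
  next
    case (snoc b s)
    then show ?case using L[of "f s"] by (simp add: f_def c_def)
  qed
  have "embedding (\<lambda>s. str (f s))"
  proof (rule embeddingI)
    fix s b
    have "f (s @ [b]) = c (f s) b" for b by (simp add: f_def)
    then show "prefix (str (f s)) (str (f (s @ [b])))" "\<not> prefix (str (f (s @ [b]))) (str (f (s @ [\<not> b])))"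
      using L[of "f s"] fT[of s] by (auto simp: c_def)
  qed
  moreover have "range (\<lambda>s. str (f s)) \<subseteq> T" 
  proof
    fix t assume "t \<in> range (\<lambda>s. str (f s))"
    then obtain s where "t = str (f s)" by blast
    then show "t \<in> T" using fT[of s] by auto
  qed
  moreover have "string_computable A (\<lambda>s. str (f s))"
  proof -
    \<comment> \<open>For \<open>i\<close> below the length, \<open>?D x i\<close> is the code of
      the string without its first \<open>i\<close> bits; the next bit is \<open>True\<close>
      exactly when this code is positive and even.\<close>
    let ?D = "\<lambda>x i. (x - (2 ^ i - 1)) div 2 ^ i"
    let ?g = "\<lambda>x i. rec_nat r0 (\<lambda>i r. if 0 < ?D x i \<and> \<not> odd (?D x i) then p2 (L r) else p1 (L r)) i"
    have "computable_from A (\<lambda>x. ?g x (length (str x)))"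
      by (intro comp_intros comp_compose[OF L_comp])
    moreover have "?g x i = f (take i (str x))" if "i \<le> length (str x)" for x i
      using that
    proof (induction i)
      case (Suc i)
      then have D: "?D x i = string_code (drop i (str x))"
        using code_length_eq(2)[of "take i (str x)" i "drop i (str x)"] by simp
      have dr: "drop i (str x) = str x ! i # drop (Suc i) (str x)"
        using Suc.prems by (simp add: Cons_nth_drop_Suc)
      have "0 < ?D x i \<and> \<not> odd (?D x i) \<longleftrightarrow> str x ! i" unfolding D dr by auto
      moreover have "f (take (Suc i) (str x)) = c (f (take i (str x))) (str x ! i)"
        using Suc.prems by (simp add: f_def take_Suc_conv_app_nth)
      ultimately show ?case using Suc by (simp add: c_def)
    qed (simp add: f_def)
    ultimately show ?thesis unfolding string_computable_def by simp
  qed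
  ultimately show ?thesis by blast
qed

text \<open>An embedding never shortens strings, so a preimage of a string with code
  \<open>x\<close> has code at most \<open>2 * x\<close>, and a bounded search decides the
  range.\<close>

lemma range_reducible:
  assumes "embedding h" "string_computable A h"
  shows "string_code ` range h \<sqsubseteq> A"
proof -
  let ?h = "\<lambda>x. string_code (h (str x))"
  have "x \<in> string_code ` range h \<longleftrightarrow> (\<exists>c<2 * x + 1. ?h c = x)" for x
  proof
    assume "x \<in> string_code ` range h"
    then obtain s where s: "x = string_code (h s)" by auto
    have "string_code s + 1 < 2 * 2 ^ length s" by (rule code_bounds)
    also have "\<dots> \<le> 2 * 2 ^ length (h s)" using embedding_length[OF assms(1), of s] by simp
    also have "\<dots> \<le> 2 * (x + 1)" using code_bounds(1)[of "h s"] by (simp add: s)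
    finally show "\<exists>c<2 * x + 1. ?h c = x" by (intro exI[of _ "string_code s"]) (simp add: s)
  qed auto
  moreover have "decidable_from A (\<lambda>x. \<exists>c<2 * x + 1. ?h c = x)"
    using comp_compose[OF assms(2)[unfolded string_computable_def] comp_snd[OF comp_id]]
    by (intro comp_intros)
  ultimately show ?thesis unfolding reducible_def by simp
qed


section \<open>Compactness\<close>

text \<open>Koenig's lemma. \<open>E n d\<close> says that for every \<open>N\<close> the first
  \<open>n\<close> values of \<open>d\<close> begin a solution of \<open>V N\<close>; the path is
  built by keeping this true.\<close>

lemma bounded_compactness:
  fixes V :: "nat \<Rightarrow> (nat \<Rightarrow> nat) \<Rightarrow> bool"
  assumes local: "\<And>N c d. (\<forall>i<N. c i = d i) \<Longrightarrow> V N c \<Longrightarrow> V N d"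
    and anti: "\<And>N M c. M \<le> N \<Longrightarrow> V N c \<Longrightarrow> V M c"
    and ex: "\<And>N. \<exists>c. (\<forall>i. c i < K) \<and> V N c"
  shows "\<exists>c. (\<forall>i. c i < K) \<and> (\<forall>N. V N c)"
proof -
  define E where "E n d \<longleftrightarrow> (\<forall>N. \<exists>c. (\<forall>i. c i < K) \<and> (\<forall>i<n. c i = d i) \<and> V N c)"
    for n and d :: "nat \<Rightarrow> nat"
  have step: "\<exists>a<K. E (Suc n) (d(n := a))" if E: "E n d" for n d
  proof (rule ccontr)
    assume "\<not> ?thesis"
    then have "\<forall>a\<in>{..<K}. \<exists>N. \<not> (\<exists>c. (\<forall>i. c i < K) \<and> (\<forall>i<Suc n. c i = (d(n := a)) i) \<and> V N c)"
      unfolding E_def by blast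
    \<comment> \<open>If each next value \<open>a\<close> failed at some \<open>N a\<close>,
      consider a solution at the maximum of these: by \<open>anti\<close> its own next value does
      not fail.\<close>
    then obtain N where N: "\<And>a. a < K \<Longrightarrow> \<not> (\<exists>c. (\<forall>i. c i < K) \<and> (\<forall>i<Suc n. c i = (d(n := a)) i) \<and> V (N a) c)"
      by (metis lessThan_iff)
    obtain c where c: "\<forall>i. c i < K" "\<forall>i<n. c i = d i" "V (Max (N ` {..<K})) c" using E unfolding E_def by blast
    have "V (N (c n)) c" by (rule anti[OF _ c(3)]) (use c(1) in auto)
    then show False using N[of "c n"] c by (auto simp: less_Suc_eq)
  qed
  have E0: "E 0 d" for d using ex unfolding E_def by simp
  define D where "D = rec_nat (\<lambda>_. 0) (\<lambda>n d. d(n := SOME a. a < K \<and> E (Suc n) (d(n := a))))"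
  have DS: "D (Suc n) = (D n)(n := SOME a. a < K \<and> E (Suc n) ((D n)(n := a)))" for n by (simp add: D_def)
  have D: "E n (D n)" for n
  proof (induction n)
    case (Suc n)
    from someI_ex[OF step[OF Suc, unfolded Bex_def]] show ?case unfolding DS by blast
  qed (rule E0)
  have DK: "D (Suc n) n < K" for n
    using someI_ex[OF step[OF D[of n], unfolded Bex_def]] by (simp add: DS)
  have agree: "i < n \<Longrightarrow> D n i = D (Suc i) i" for n i
  proof (induction n)
    case (Suc n)
    show ?case
    proof (cases "i = n")
      case False
      then have "D (Suc n) i = D n i" by (simp add: DS)
      then show ?thesis using False Suc by simp
    qed simp
  qed simp
  show ?thesis
  proof (intro exI[of _ "\<lambda>i. D (Suc i) i"] conjI allI)
    fix N
    obtain c where c: "\<forall>i<N. c i = D N i" "V N c" using D[of N] unfolding E_def by blast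
    show "V N (\<lambda>i. D (Suc i) i)" by (rule local[OF _ c(2)]) (metis agree c(1))
  qed (rule DK)
qed


section \<open>Conditions\<close>

definition good :: "bool list set \<Rightarrow> nat set \<Rightarrow> bool" where
  "good S A \<longleftrightarrow> \<not> computes_bounded_enumeration A S"

definition level_codes :: "bool list set \<Rightarrow> nat \<Rightarrow> nat set" where
  "level_codes S n = string_code ` (S \<inter> {s. length s = n})"

definition hits :: "bool list set \<Rightarrow> nat \<Rightarrow> nat \<Rightarrow> nat option \<Rightarrow> bool" where
  "hits S l n v \<longleftrightarrow> (\<exists>y. v = Some y \<and> card (set_decode y) \<le> l \<and> set_decode y \<inter> level_codes S n \<noteq> {})"

text \<open>Avoidance splits into one requirement for each functional \<open>e\<close> and bound
  \<open>l\<close>, and a single \<open>n\<close> settles it. The forcing meets these requirements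
  one by one.\<close>

lemma goodI:
  assumes "\<And>e l. \<exists>n. \<not> hits S l n (run e A n)"
  shows "good S A"
  unfolding good_def
proof
  assume "computes_bounded_enumeration A S"
  then obtain g l e where g: "\<And>n. finite (g n)" "\<And>n. card (g n) \<le> l"
      "\<And>n. g n \<inter> S \<inter> {s. length s = n} \<noteq> {}"
      and e: "\<And>n. run e A n = Some (set_encode (string_code ` g n))"
    unfolding computes_bounded_enumeration_def bounded_enumeration_def l_enumeration_def computable_from_def
    by blast
  have "hits S l n (run e A n)" for n
  proof -
    have "set_decode (set_encode (string_code ` g n)) = string_code ` g n" using g(1) by simp
    moreover have "card (string_code ` g n) \<le> l" using g(2) card_image_le[OF g(1)] by (meson le_trans)
    moreover have "string_code ` g n \<inter> level_codes S n \<noteq> {}"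
      using g(3)[of n] unfolding level_codes_def by blast
    ultimately show ?thesis unfolding hits_def e by simp
  qed
  with assms show False by blast
qed

lemma not_goodI:
  assumes "computable_from A f"
    and "\<And>n. card (set_decode (f n)) \<le> l" "\<And>n. set_decode (f n) \<inter> level_codes S n \<noteq> {}"
  shows "\<not> good S A"
proof -
  define g where "g n = str ` set_decode (f n)" for n
  have "string_code ` g n = set_decode (f n)" for n by (simp add: g_def image_image)
  then have "computable_from A (\<lambda>n. set_encode (string_code ` g n))" using assms(1) by simp
  moreover have "finite (g n)" "card (g n) \<le> l" "g n \<inter> S \<inter> {s. length s = n} \<noteq> {}" for n
    using assms(2,3)[of n] card_image_le[of "set_decode (f n)" str] unfolding g_def level_codes_def
    by (auto intro: le_trans)
  ultimately show ?thesis
    unfolding good_def computes_bounded_enumeration_def bounded_enumeration_def l_enumeration_def by blast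
qed

lemma good_reducible: "good S A \<Longrightarrow> X \<sqsubseteq> A \<Longrightarrow> good S X"
  unfolding good_def using computes_reducible by blast

text \<open>Solutions are kept as computable embeddings because these compose. The oracle
  \<open>A\<close> may contain more than \<open>D\<close> and the solution;
  \<open>range_reducible\<close> leads back to the set itself.\<close>

definition solvable :: "bool list set \<Rightarrow> nat set \<Rightarrow> (bool list \<Rightarrow> bool) \<Rightarrow> bool" where
  "solvable S D P \<longleftrightarrow>
     (\<exists>A h. D \<sqsubseteq> A \<and> good S A \<and> embedding h \<and> string_computable A h \<and> (\<forall>s. P (h s)))"

text \<open>
  A condition \<open>(A, m, H)\<close> approximates a solution by the values of \<open>H\<close> on the strings shorter than
  \<open>m\<close>; the cones of \<open>H\<close> above level \<open>m\<close> are the reservoirs for the rest of the solution.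
\<close>

definition condition ::
  "bool list set \<Rightarrow> nat set \<Rightarrow> (bool list \<Rightarrow> bool) \<Rightarrow> nat set \<Rightarrow> nat \<Rightarrow> (bool list \<Rightarrow> bool list) \<Rightarrow> bool" where
  "condition S D P A m H \<longleftrightarrow> D \<sqsubseteq> A \<and> good S A \<and> embedding H \<and> string_computable A H \<and>
     (\<forall>s. length s < m \<longrightarrow> P (H s))"

definition extends :: "nat \<Rightarrow> (bool list \<Rightarrow> bool list) \<Rightarrow> nat \<Rightarrow> (bool list \<Rightarrow> bool list) \<Rightarrow> bool" where
  "extends m H m' H' \<longleftrightarrow> m \<le> m' \<and> (\<forall>s. length s < m \<longrightarrow> H' s = H s) \<and> range H' \<subseteq> range H"

definition finite_extension :: "nat \<Rightarrow> (bool list \<Rightarrow> bool list) \<Rightarrow> nat \<Rightarrow> (bool list \<Rightarrow> bool list) \<Rightarrow> bool" where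
  "finite_extension m H q g \<longleftrightarrow> m \<le> q \<and> (\<forall>s. length s < m \<longrightarrow> g s = H s) \<and>
     (\<forall>s t. length s < q \<longrightarrow> length t < q \<longrightarrow> (prefix (g s) (g t) \<longleftrightarrow> prefix s t)) \<and>
     (\<forall>s. length s < q \<longrightarrow> g s \<in> range H)"

definition part :: "nat \<Rightarrow> (bool list \<Rightarrow> bool list) \<Rightarrow> nat set" where
  "part q g = string_code ` g ` {s. length s < q}"

text \<open>No colour is asked of the finite extensions, so forcing concerns the reservoirs only. A
  failure to force thus provides an extension inside thinned reservoirs that may be wrong for
  \<open>P\<close> but is right for a suitable colouring homogeneous on them.\<close>

definition forces ::
  "bool list set \<Rightarrow> nat set \<Rightarrow> nat \<Rightarrow> (bool list \<Rightarrow> bool list) \<Rightarrow> functional \<Rightarrow> nat \<Rightarrow> nat \<Rightarrow> bool" where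
  "forces S D m H e l n \<longleftrightarrow>
     (\<forall>q g. finite_extension m H q g \<longrightarrow> \<not> hits S l n (run e (join D (part q g)) n))"

definition stuck :: "bool list set \<Rightarrow> nat set \<Rightarrow> (bool list \<Rightarrow> bool) \<Rightarrow> nat set \<Rightarrow> nat \<Rightarrow>
    (bool list \<Rightarrow> bool list) \<Rightarrow> functional \<Rightarrow> nat \<Rightarrow> bool" where
  "stuck S D P A m H e l \<longleftrightarrow> condition S D P A m H \<and>
     (\<forall>A' m' H' n. A \<sqsubseteq> A' \<longrightarrow> condition S D P A' m' H' \<longrightarrow> extends m H m' H' \<longrightarrow>
        \<not> forces S D m' H' e l n)"

section \<open>Extending conditions\<close>

lemma extends_refl: "extends m H m H" by (simp add: extends_def)

lemma extends_trans: "extends m H m' H' \<Longrightarrow> extends m' H' m'' H'' \<Longrightarrow> extends m H m'' H''"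
  unfolding extends_def by fastforce

lemma finite_extension_extends:
  "extends m H m' H' \<Longrightarrow> finite_extension m' H' q g \<Longrightarrow> finite_extension m H q g"
  unfolding extends_def finite_extension_def by fastforce

lemma forces_extends: "extends m H m' H' \<Longrightarrow> forces S D m H e l n \<Longrightarrow> forces S D m' H' e l n"
  unfolding forces_def using finite_extension_extends by blast

lemma condition_reducible: "condition S D P A m H \<Longrightarrow> A \<sqsubseteq> A' \<Longrightarrow> good S A' \<Longrightarrow> condition S D P A' m H"
  unfolding condition_def using string_computable_reducible reducible_trans by blast

lemma stuck_extends:
  "stuck S D P A m H e l \<Longrightarrow> A \<sqsubseteq> A' \<Longrightarrow> condition S D P A' m' H' \<Longrightarrow> extends m H m' H' \<Longrightarrow>
    stuck S D P A' m' H' e l"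
  unfolding stuck_def using reducible_trans extends_trans by blast

lemma stuck_reducible:
  "stuck S D P A m H e l \<Longrightarrow> A \<sqsubseteq> A' \<Longrightarrow> good S A' \<Longrightarrow> stuck S D P A' m H e l"
  by (rule stuck_extends[OF _ _ condition_reducible extends_refl]) (auto simp: stuck_def)

lemma join_part_agree:
  assumes "\<And>z. z < u \<Longrightarrow> z \<in> X \<longleftrightarrow> z \<in> Y"
  shows "\<forall>z<u. z \<in> join D X \<longleftrightarrow> z \<in> join D Y"
proof (intro allI impI)
  fix z assume "z < u"
  then have "z div 2 < u" by simp
  with assms show "z \<in> join D X \<longleftrightarrow> z \<in> join D Y" by (simp add: mem_join)
qed

text \<open>A reservoir without a string of the wanted colour would itself solve the complement. So
  each reservoir offers such a string, which becomes the new node at level \<open>m\<close>.\<close>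

lemma extend_level:
  assumes c: "condition S D P A m H" and ns: "\<not> solvable S D (\<lambda>s. \<not> P s)"
  shows "\<exists>H'. condition S D P A (Suc m) H' \<and> extends m H (Suc m) H'"
proof -
  have H: "embedding H" "string_computable A H" and DA: "D \<sqsubseteq> A" "good S A"
    using c unfolding condition_def by auto
  have "\<exists>x. P (H (t @ x))" for t
  proof (rule ccontr)
    assume "\<not> ?thesis"
    then have "solvable S D (\<lambda>s. \<not> P s)"
      unfolding solvable_def using DA embedding_comp[OF H(1) embedding_append[of t]]
        string_computable_comp[OF H(2) string_computable_append[of A t]] by blast
    with ns show False ..
  qed
  then obtain w where w: "\<And>t. P (H (t @ w t))" by metis
  define J where "J = glue m (\<lambda>s. s) (\<lambda>t x. t @ w t @ x)"
  have J: "embedding J" unfolding J_def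
  proof (rule embedding_glue)
    show "prefix s (t @ w t @ x) \<longleftrightarrow> prefix s t" if "length s < m" "length t = m" for s t x
      using that by (auto simp: prefix_append)
    show "\<not> prefix (t @ w t @ x) s" if "length s < m" "length t = m" for s t x
      using that by (auto dest: prefix_length_le)
    show "t = t'" if "length t = m" "length t' = m" "prefix (t @ w t @ x) (t' @ w t' @ y)" for t t' x y
      using that by (auto elim!: prefixE)
    show "embedding (\<lambda>x. t @ w t @ x)" for t by (simp add: embedding_def)
  qed simp
  have "string_computable A J" unfolding J_def
    using string_computable_append[of A "t @ w t" for t] by (intro string_computable_glue) simp
  moreover have "J s = (if length s < m then s else s @ w s)" if "length s < Suc m" for s
    using that by (auto simp: J_def glue_def)
  moreover from this have "P (H (J s))" if "length s < Suc m" for s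
    using that w[of s] c unfolding condition_def by auto
  ultimately show ?thesis
    using DA embedding_comp[OF H(1) J] string_computable_comp[OF H(2)]
    by (intro exI[of _ "\<lambda>s. H (J s)"]) (auto simp: condition_def extends_def)
qed

text \<open>Step \<open>n\<close> meets requirement \<open>n\<close> and adds a level. Only
  \<open>D\<close> and the finite parts enter the oracle of the limit, so the growing oracles of the
  steps need no good common upper bound.\<close>

lemma generic_solution:
  assumes c0: "condition S D P A0 m0 H0" and ns: "\<not> solvable S D (\<lambda>s. \<not> P s)"
    and free: "\<And>A m H e l. A0 \<sqsubseteq> A \<Longrightarrow> extends m0 H0 m H \<Longrightarrow> \<not> stuck S D P A m H e l"
  shows "solvable S D P"
proof -
  \<comment> \<open>Functionals are countable, so this lists all pairs of a functional and a
    bound.\<close>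
  define req :: "nat \<Rightarrow> functional \<times> nat" where "req = from_nat"
  define ok where "ok = (\<lambda>(A, m, H). condition S D P A m H \<and> A0 \<sqsubseteq> A \<and> extends m0 H0 m H)"
  define next' where "next' n = (\<lambda>(A :: nat set, m, H) (A' :: nat set, m', H'). m < m' \<and> extends m H m' H' \<and>
    (\<exists>k. forces S D m' H' (fst (req n)) (snd (req n)) k))" for n
  have "\<exists>y. ok y \<and> next' n x y" if "ok x" for n x
  proof -
    obtain A m H where x: "x = (A, m, H)" by (cases x)
    have c: "condition S D P A m H" "A0 \<sqsubseteq> A" "extends m0 H0 m H" using that by (auto simp: ok_def x)
    let ?e = "fst (req n)" and ?l = "snd (req n)"
    from free[OF c(2,3), of ?e ?l] c(1) obtain A' m' H' k where
      1: "A \<sqsubseteq> A'" "condition S D P A' m' H'" "extends m H m' H'" "forces S D m' H' ?e ?l k"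
      unfolding stuck_def by blast
    from extend_level[OF 1(2) ns] obtain H'' where
      2: "condition S D P A' (Suc m') H''" "extends m' H' (Suc m') H''" by blast
    have "ok (A', Suc m', H'')"
      using 1 2 c reducible_trans[of A0 A A'] extends_trans[OF extends_trans[OF c(3) 1(3)] 2(2)]
      by (simp add: ok_def)
    moreover have "next' n x (A', Suc m', H'')"
      using extends_trans[OF 1(3) 2(2)] forces_extends[OF 2(2) 1(4)] 1(3) unfolding next'_def x
      by (auto simp: extends_def[of m H m' H'] intro!: exI[of _ k])
    ultimately show ?thesis by blast
  qed
  moreover have "ok (A0, m0, H0)" using c0 by (simp add: ok_def reducible_refl extends_refl)
  ultimately obtain f where f: "\<And>n. ok (f n)" "\<And>n. next' n (f n) (f (Suc n))"
    using dependent_nat_choice[of "\<lambda>_. ok" "next'"] by blast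
  define a b h where "a n = fst (f n)" and "b n = fst (snd (f n))" and "h n = snd (snd (f n))" for n
  have cond: "condition S D P (a n) (b n) (h n)" for n
    using f(1)[of n] by (auto simp: ok_def a_def b_def h_def split: prod.splits)
  have step: "b n < b (Suc n)" "extends (b n) (h n) (b (Suc n)) (h (Suc n))"
    "\<exists>k. forces S D (b (Suc n)) (h (Suc n)) (fst (req n)) (snd (req n)) k" for n
    using f(2)[of n] by (auto simp: next'_def b_def h_def split: prod.splits)
  have ext: "extends (b n) (h n) (b n') (h n')" if "n \<le> n'" for n n'
    using that by (induction rule: dec_induct) (auto intro: extends_refl extends_trans step(2))
  have bn: "n \<le> b n" for n
    by (induction n) (use step(1) in \<open>auto simp: Suc_le_eq intro: le_less_trans\<close>)
  \<comment> \<open>Each step adds at least one level, so the value at \<open>s\<close> is final by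
    stage \<open>Suc (length s)\<close>.\<close>
  define G where "G s = h (Suc (length s)) s" for s
  have G: "G s = h n s" if "length s < b n" for s n
  proof (cases "n \<le> Suc (length s)")
    case True
    then show ?thesis using ext[OF True] that by (simp add: G_def extends_def)
  next
    case False
    then have "Suc (length s) \<le> n" by simp
    from ext[OF this] show ?thesis using bn[of "Suc (length s)"] by (simp add: G_def extends_def)
  qed
  have emb: "embedding G" unfolding embedding_def
  proof (intro allI)
    fix s t :: "bool list"
    let ?n = "Suc (max (length s) (length t))"
    have "length s < b ?n" "length t < b ?n" using bn[of ?n] by auto
    then have "G s = h ?n s" "G t = h ?n t" using G by blast+
    then show "prefix (G s) (G t) \<longleftrightarrow> prefix s t"
      using cond[of ?n] by (simp add: condition_def embedding_def)
  qed
  have ran: "G s \<in> range (h n)" for s n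
  proof -
    let ?n = "max n (Suc (length s))"
    have "length s < b ?n" using bn[of ?n] by auto
    then have "G s \<in> range (h ?n)" using G by simp
    moreover have "range (h ?n) \<subseteq> range (h n)" using ext[of n ?n] by (simp add: extends_def)
    ultimately show ?thesis by blast
  qed
  have PG: "P (G s)" for s
    using cond[of "Suc (length s)"] bn[of "Suc (length s)"] by (simp add: G_def condition_def)
  define A where "A = join D (string_code ` range G)"
  have "good S A"
  proof (rule goodI)
    fix e :: functional and l :: nat
    define n where "n = to_nat (e, l)"
    have "req n = (e, l)" by (simp add: n_def req_def)
    with step(3)[of n] obtain k where k: "forces S D (b (Suc n)) (h (Suc n)) e l k" by auto
    have "\<not> hits S l k (run e A k)"
    proof
      assume hit: "hits S l k (run e A k)"
      then obtain y where y: "run e A k = Some y" unfolding hits_def by blast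
      from run_use[OF this] obtain u where u: "\<And>Y. \<forall>z<u. z \<in> A \<longleftrightarrow> z \<in> Y \<Longrightarrow> run e Y k = Some y" by blast
      \<comment> \<open>Codes below the use \<open>u\<close> can only come from strings shorter than
        \<open>u\<close>, since codes bound lengths and embeddings do not shorten strings.\<close>
      let ?q = "max (b (Suc n)) u"
      have "finite_extension (b (Suc n)) (h (Suc n)) ?q G"
        using emb G ran by (auto simp: finite_extension_def embedding_def)
      moreover have "run e (join D (part ?q G)) k = Some y"
      proof (rule u, unfold A_def, rule join_part_agree)
        fix z assume "z < u"
        show "z \<in> string_code ` range G \<longleftrightarrow> z \<in> part ?q G"
        proof
          assume "z \<in> string_code ` range G"
          then obtain s where s: "z = string_code (G s)" by auto
          then have "length s \<le> z" using embedding_length[OF emb, of s] length_le_code[of "G s"] by simp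
          with \<open>z < u\<close> s show "z \<in> part ?q G" unfolding part_def by auto
        qed (auto simp: part_def)
      qed
      ultimately show False using k hit y unfolding forces_def by metis
    qed
    then show "\<exists>k. \<not> hits S l k (run e A k)" ..
  qed
  moreover have "D \<sqsubseteq> A" unfolding A_def by (rule reducible_join1)
  moreover have "decidable_from A (\<lambda>x. x \<in> string_code ` range G)"
    using reducible_join2[of "string_code ` range G" D] unfolding A_def reducible_def .
  \<comment> \<open>\<open>G\<close> need not be computable from its range, but some embedding into
    the range is.\<close>
  from computable_embedding[OF this emb refl] obtain g where
    "embedding g" "string_computable A g" "range g \<subseteq> range G" by blast
  moreover from this have "P (g s)" for s using PG by (metis imageE rangeI subsetD)
  ultimately show ?thesis unfolding solvable_def by blast
qed

lemma ex_stuck: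
  assumes "condition S D P A m H" "\<not> solvable S D P" "\<not> solvable S D (\<lambda>s. \<not> P s)"
  obtains A' m' H' e l where "A \<sqsubseteq> A'" "extends m H m' H'" "stuck S D P A' m' H' e l"
  using generic_solution[OF assms(1,3)] assms(2) by blast

text \<open>A computation with the wrong value is preserved by thinning the reservoirs above its use.\<close>

lemma stuck_no_wrong_value:
  assumes st: "stuck S D P A m H e l" and g: "finite_extension m H q g"
    and Pg: "\<And>s. length s < q \<Longrightarrow> P (g s)"
    and y: "run e (join D (part q g)) n = Some y" "set_decode y \<inter> level_codes S n = {}"
  shows False
proof -
  have c: "D \<sqsubseteq> A" "good S A" "embedding H" "string_computable A H"
    using st unfolding stuck_def condition_def by auto
  from g have mq: "m \<le> q" and gH: "\<And>s. length s < m \<Longrightarrow> g s = H s"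
    and ginc: "\<And>s t. length s < q \<Longrightarrow> length t < q \<Longrightarrow> prefix (g s) (g t) \<longleftrightarrow> prefix s t"
    and "\<And>s. length s < q \<Longrightarrow> g s \<in> range H"
    unfolding finite_extension_def by auto
  then have "\<forall>s. \<exists>r. length s < q \<longrightarrow> g s = H r" by blast
  \<comment> \<open>The finite extension is pulled back along \<open>H\<close> to a finite tree
    \<open>j\<close> of positions.\<close>
  then obtain j where j: "\<And>s. length s < q \<Longrightarrow> g s = H (j s)" by (elim choice[THEN exE]) blast
  have jinc: "prefix (j s) (j t) \<longleftrightarrow> prefix s t" if "length s < q" "length t < q" for s t
    using ginc[OF that] j[OF that(1)] j[OF that(2)] c(3) by (simp add: embedding_def)
  from run_use[OF y(1)] obtain u where
    u: "\<And>Y. \<forall>z<u. z \<in> join D (part q g) \<longleftrightarrow> z \<in> Y \<Longrightarrow> run e Y n = Some y" by blast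
  \<comment> \<open>The new cone above \<open>t\<close> starts from the place of the parent of
    \<open>t\<close>, takes the last bit of \<open>t\<close>, and is then raised by \<open>u\<close>
    bits, so that all its strings have codes at least \<open>u\<close>. For \<open>q = 0\<close>
    there is no parent.\<close>
  define B where "B t = (if q = 0 then [] else j (butlast t) @ [last t]) @ replicate u False" for t
  define J where "J = glue q j (\<lambda>t x. B t @ x)"
  have short_B: "prefix (j s) (B t @ x) \<longleftrightarrow> prefix s t" "\<not> prefix (B t @ x) (j s)"
    if "length s < q" "length t = q" for s t x
  proof -
    from that have q: "q \<noteq> 0" "t \<noteq> []" by auto
    define t' where "t' = butlast t"
    have t: "t = t' @ [last t]" "length t' < q" "length s \<le> length t'" using q that by (auto simp: t'_def)
    have B: "B t @ x = j t' @ last t # replicate u False @ x" using q by (simp add: B_def t'_def)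
    have 1: "\<not> prefix (j t' @ c) (j s)" if "c \<noteq> []" for c
    proof
      assume pre: "prefix (j t' @ c) (j s)"
      then have "prefix (j t') (j s)" by (rule append_prefixD)
      then have "prefix t' s" using jinc t(2) \<open>length s < q\<close> by simp
      then obtain d where "s = t' @ d" by (elim prefixE)
      then have "t' = s" using t(3) by simp
      with pre that show False by (auto dest: prefix_length_le)
    qed
    show "\<not> prefix (B t @ x) (j s)" unfolding B using 1 by blast
    show "prefix (j s) (B t @ x) \<longleftrightarrow> prefix s t"
    proof
      assume a: "prefix (j s) (B t @ x)"
      have "prefix (j s) (j t')"
      proof (rule ccontr)
        assume n: "\<not> prefix (j s) (j t')"
        have "prefix (j t') (B t @ x)" unfolding B by simp
        with n have "prefix (j t') (j s)" using prefix_same_cases[OF a] by blast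
        then obtain c where "j s = j t' @ c" by (elim prefixE)
        with n 1[of c] show False by (cases "c = []") auto
      qed
      then show "prefix s t" using jinc t that(1) by (metis prefix_append)
    next
      assume "prefix s t"
      then have "prefix s t'" using t(1) that by (metis prefix_snoc less_irrefl)
      then have "prefix (j s) (j t')" using jinc t(2) that(1) by simp
      then show "prefix (j s) (B t @ x)" unfolding B by simp
    qed
  qed
  have B_inc: "t = t'" if "length t = q" "length t' = q" "prefix (B t @ x) (B t' @ y)" for t t' x y
  proof (cases "q = 0")
    case False
    have "B t @ x = j (butlast t) @ last t # replicate u False @ x" for t x
      using False by (simp add: B_def)
    with that(3) have pre: "prefix (j (butlast t) @ last t # replicate u False @ x)
      (j (butlast t') @ last t' # replicate u False @ y)" by simp
    then have "prefix (j (butlast t)) (j (butlast t')) \<or> prefix (j (butlast t')) (j (butlast t))"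
      by (meson append_prefixD prefixI prefix_same_cases)
    moreover have len: "length (butlast t) = length (butlast t')" "length (butlast t) < q"
      using that(1,2) False by auto
    ultimately have "prefix (butlast t) (butlast t') \<or> prefix (butlast t') (butlast t)"
      using jinc[of "butlast t" "butlast t'"] jinc[of "butlast t'" "butlast t"] by simp
    moreover have "a = b" if "prefix a b" "length a = length b" for a b :: "bool list"
      using that by (auto elim!: prefixE)
    ultimately have b: "butlast t = butlast t'" using len(1) by metis
    with pre have l: "last t = last t'" by simp
    have "t \<noteq> []" "t' \<noteq> []" using that(1,2) False by auto
    then have "t = butlast t @ [last t]" "butlast t' @ [last t'] = t'" by simp_all
    then show ?thesis unfolding b l by (rule trans)
  qed (use that in auto)
  have J: "embedding J" unfolding J_def
  proof (rule embedding_glue)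
    show "embedding (\<lambda>x. B t @ x)" for t by (rule embedding_append)
  qed ((rule jinc short_B B_inc; assumption)+)
  have Jc: "string_computable A J" unfolding J_def
    by (intro string_computable_glue string_computable_append)
  define H' where "H' s = H (J s)" for s
  have H'g: "H' s = g s" if "length s < q" for s using that j by (simp add: H'_def J_def glue_def)
  have H'_long: "u \<le> string_code (H' t)" if "\<not> length t < q" for t
  proof -
    have "u \<le> length (J t)" using that by (simp add: J_def glue_def B_def)
    also have "\<dots> \<le> length (H' t)" unfolding H'_def by (rule embedding_length[OF c(3)])
    also have "\<dots> \<le> string_code (H' t)" by (rule length_le_code)
    finally show ?thesis .
  qed
  have H'e: "embedding H'" unfolding H'_def by (rule embedding_comp[OF c(3) J])
  have "condition S D P A q H'"
    using c H'e string_computable_comp[OF c(4) Jc] Pg H'g by (simp add: condition_def H'_def[abs_def])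
  moreover have "extends m H q H'"
    using mq gH H'g by (auto simp: extends_def) (simp add: H'_def)
  moreover have "forces S D q H' e l n" unfolding forces_def
  proof (intro allI impI)
    fix q' g' assume g': "finite_extension q H' q' g'"
    have "run e (join D (part q' g')) n = Some y"
    proof (rule u, rule join_part_agree)
      fix z assume z: "z < u"
      show "z \<in> part q g \<longleftrightarrow> z \<in> part q' g'"
      proof
        assume "z \<in> part q g"
        then obtain s where "length s < q" "z = string_code (g s)" by (auto simp: part_def)
        moreover from this g' have "g' s = g s" "length s < q'"
          using H'g by (auto simp: finite_extension_def)
        ultimately show "z \<in> part q' g'" unfolding part_def by (metis imageI mem_Collect_eq)
      next
        assume "z \<in> part q' g'"
        then obtain s where s: "length s < q'" "z = string_code (g' s)" by (auto simp: part_def)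
        obtain t where t: "g' s = H' t" using g' s(1) unfolding finite_extension_def by blast
        \<comment> \<open>A string with code below \<open>u\<close> cannot come from the raised
          cones, so it belongs to the old finite part.\<close>
        have "length t < q" using H'_long[of t] z s(2) t by auto
        moreover from this g' have "g' t = H' t" "length t < q'" by (auto simp: finite_extension_def)
        ultimately show "z \<in> part q g"
          using s(2) t H'g unfolding part_def by (metis imageI mem_Collect_eq)
      qed
    qed
    then show "\<not> hits S l n (run e (join D (part q' g')) n)" using y(2) by (simp add: hits_def)
  qed
  ultimately show False using st reducible_refl unfolding stuck_def by blast
qed


section \<open>Homogeneous sets for closed classes\<close>

text \<open>\<open>V r n\<close> rejects the segment of length \<open>n\<close> with code
  \<open>r\<close>. For decidable \<open>V\<close> this is an effectively closed class with
  \<open>K\<close> colours, to which avoidance for \<open>k\<close> colours does not apply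
  directly.\<close>

definition closed_class :: "nat \<Rightarrow> (nat \<Rightarrow> nat \<Rightarrow> bool) \<Rightarrow> (nat \<Rightarrow> nat) set" where
  "closed_class K V = {c. (\<forall>i. c i < K) \<and> (\<forall>n. \<not> V (digits K n c) n)}"

text \<open>A projection along a compact space is again closed: the member \<open>c\<close> may be
  replaced by one candidate segment for every length. The two colours of \<open>C\<close> separate
  the value \<open>a\<close> from the values in \<open>B\<close>.\<close>

lemma projection_Pi01_class:
  assumes V: "decidable_from A (\<lambda>p. V (p1 p) (p2 p))" and h: "computable_from A h"
    and B: "finite B" and K: "K > 0"
  shows "Pi01_class A k {C \<in> colorings k. \<exists>c \<in> closed_class K V. \<forall>i.
    C (str i) = 0 \<and> c (h i) = a \<or> C (str i) = 1 \<and> c (h i) \<in> B}"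
    (is "Pi01_class A k ?Q")
proof -
  define len where "len x = length (list_decode x)" for x
  have len: "computable_from A (\<lambda>x. len (f x))" if "computable_from A f" for f
    unfolding len_def by (intro comp_intros that)
  let ?rel = "\<lambda>x y. x = 0 \<and> y = a \<or> x = 1 \<and> y \<in> B"
  \<comment> \<open>One length serves for the segment of \<open>C\<close> and the candidate segment
    \<open>r\<close> of \<open>c\<close>. The test at \<open>i\<close> waits until
    \<open>h i\<close> lies below it, as happens for all long enough segments.\<close>
  define R where "R = {x. \<exists>r<K ^ len x. (\<forall>n<Suc (len x). \<not> V (r mod K ^ n) n) \<and>
    (\<forall>i<len x. h i < len x \<longrightarrow> ?rel (entry x i) (digit K r (h i)))}"
  have "decidable_from A (\<lambda>x. x \<in> R)"
    unfolding R_def mem_Collect_eq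
    by (intro comp_intros len dec_compose2[OF V] dec_finite_set[OF B] comp_compose[OF h])
  then have "computable_set_from A R" unfolding computable_set_from_def decidable_from_def .
  moreover have "C \<in> ?Q \<longleftrightarrow> (\<forall>n. restriction_code C n \<in> R)" if "C \<in> colorings k" for C
  proof -
    have len_C: "len (restriction_code C n) = n" for n by (simp add: len_def restriction_code_def)
    have entry_C: "entry (restriction_code C n) i = C (str i)" if "i < n" for i n
      unfolding restriction_code_def using that by (simp add: entry_list_encode)
    show ?thesis
    proof
      assume "C \<in> ?Q"
      then obtain c where c: "\<And>i. c i < K" "\<And>n. \<not> V (digits K n c) n" "\<And>i. ?rel (C (str i)) (c (h i))"
        unfolding closed_class_def by blast
      show "\<forall>n. restriction_code C n \<in> R"
      proof
        fix n
        have "digits K n c < K ^ n" using c(1) by (intro digits_less) auto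
        moreover have "\<not> V (digits K n c mod K ^ i) i" if "i < Suc n" for i
          using that c(2) by (simp add: digits_mod[OF c(1)])
        moreover have "?rel (entry (restriction_code C n) i) (digit K (digits K n c) (h i))"
          if "i < n" "h i < n" for i
          using c(3)[of i] digit_digits[of n c K "h i", OF c(1) that(2)] entry_C[OF that(1)] by simp
        ultimately show "restriction_code C n \<in> R" unfolding R_def mem_Collect_eq len_C by blast
      qed
    next
      assume R: "\<forall>n. restriction_code C n \<in> R"
      have "\<exists>c. (\<forall>i. c i < K) \<and> (\<forall>n. (\<forall>i<Suc n. \<not> V (digits K i c) i) \<and>
        (\<forall>i<n. h i < n \<longrightarrow> ?rel (C (str i)) (c (h i))))"
      proof (rule bounded_compactness)
        fix n
        from R have "restriction_code C n \<in> R" by blast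
        then obtain r where r: "\<And>i. i < Suc n \<Longrightarrow> \<not> V (r mod K ^ i) i"
          "\<And>i. i < n \<Longrightarrow> h i < n \<Longrightarrow> ?rel (entry (restriction_code C n) i) (digit K r (h i))"
          unfolding R_def mem_Collect_eq len_C by blast
        have "\<forall>i. digit K r i < K" using K by (simp add: digit_def)
        moreover have "\<forall>i<Suc n. \<not> V (digits K i (digit K r)) i"
          using r(1) by (simp add: digits_digit[OF K])
        moreover have "\<forall>i<n. h i < n \<longrightarrow> ?rel (C (str i)) (digit K r (h i))"
          using r(2) entry_C by metis
        ultimately show "\<exists>c. (\<forall>i. c i < K) \<and> (\<forall>i<Suc n. \<not> V (digits K i c) i) \<and>
          (\<forall>i<n. h i < n \<longrightarrow> ?rel (C (str i)) (c (h i)))" by blast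
      next
        fix n c d
        assume cd: "\<forall>i<n. c i = d i"
          and c: "(\<forall>i<Suc n. \<not> V (digits K i c) i) \<and> (\<forall>i<n. h i < n \<longrightarrow> ?rel (C (str i)) (c (h i)))"
        from cd have "digits K i c = digits K i d" if "i < Suc n" for i
          using that by (intro digits_cong) auto
        with cd c show "(\<forall>i<Suc n. \<not> V (digits K i d) i) \<and> (\<forall>i<n. h i < n \<longrightarrow> ?rel (C (str i)) (d (h i)))"
          by metis
      next
        fix n m c
        assume "m \<le> n"
          and "(\<forall>i<Suc n. \<not> V (digits K i c) i) \<and> (\<forall>i<n. h i < n \<longrightarrow> ?rel (C (str i)) (c (h i)))"
        then show "(\<forall>i<Suc m. \<not> V (digits K i c) i) \<and> (\<forall>i<m. h i < m \<longrightarrow> ?rel (C (str i)) (c (h i)))"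
          by (meson Suc_le_mono less_le_trans)
      qed
      then obtain c where c: "\<And>i. c i < K" "\<And>n i. i < Suc n \<Longrightarrow> \<not> V (digits K i c) i"
        "\<And>n i. i < n \<Longrightarrow> h i < n \<Longrightarrow> ?rel (C (str i)) (c (h i))" by blast
      have "c \<in> closed_class K V" unfolding closed_class_def using c(1,2) by blast
      moreover have "?rel (C (str i)) (c (h i))" for i
        by (rule c(3)[of _ "Suc (max i (h i))"]) auto
      ultimately show "C \<in> ?Q" using that by blast
    qed
  qed
  then have "?Q = {C \<in> colorings k. \<forall>n. restriction_code C n \<in> R}" by blast
  ultimately show ?thesis unfolding Pi01_class_def by blast
qed

text \<open>Colours are removed one at a time by two-colourings, since \<open>K\<close> may exceed
  \<open>k\<close>. Avoidance selects its own member of the class, so \<open>c\<close> is replaced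
  at every step; only the restriction of its values on the tree is maintained.\<close>

lemma homogeneous_embedding:
  assumes av: "Pi01_class_avoidance k" "k \<ge> 2"
    and V: "decidable_from A0 (\<lambda>p. V (p1 p) (p2 p))"
    and "finite B" "A0 \<sqsubseteq> A" "good S A" "embedding h" "string_computable A h"
    and "c \<in> closed_class K V" "\<And>s. c (string_code (h s)) \<in> B"
  shows "\<exists>A' g c' a. A \<sqsubseteq> A' \<and> good S A' \<and> embedding g \<and> string_computable A' g \<and>
    c' \<in> closed_class K V \<and> (\<forall>s. c' (string_code (h (g s))) = a)"
  using assms(4-)
proof (induction B arbitrary: A h c)
  case empty
  then show ?case by blast
next
  case (insert b B)
  let ?h = "\<lambda>i. string_code (h (str i))"
  let ?rel = "\<lambda>x y. x = 0 \<and> y = b \<or> x = 1 \<and> y \<in> B"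
  let ?Q = "{C \<in> colorings k. \<exists>c \<in> closed_class K V. \<forall>i. ?rel (C (str i)) (c (?h i))}"
  have "c 0 < K" using insert.prems(5) unfolding closed_class_def by blast
  then have "Pi01_class A k ?Q"
    using dec_reducible[OF V insert.prems(1)] insert.prems(4) insert.hyps
    by (intro projection_Pi01_class) (auto simp: string_computable_def)
  \<comment> \<open>The current \<open>c\<close> shows that the class is nonempty; 0 and 1 are
    colours because \<open>k \<ge> 2\<close>.\<close>
  moreover have "(\<lambda>s. if c (string_code (h s)) = b then 0 else 1) \<in> ?Q"
    using insert.prems(5,6) av(2) by (auto simp: colorings_def intro!: bexI[of _ c])
  ultimately obtain C T where C: "C \<in> ?Q" and T: "TT1_solution C T" and gT: "good S (join A (string_code ` T))"
    using av(1) insert.prems(2) unfolding Pi01_class_avoidance_def good_def by (metis (no_types, lifting) empty_iff)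
  from T obtain a f where a: "\<And>s. s \<in> T \<Longrightarrow> C s = a" and f: "embedding f" "range f = T"
    unfolding TT1_solution_def by (auto elim: perfect_treeE)
  define A' where "A' = join A (string_code ` T)"
  have AA': "A \<sqsubseteq> A'" unfolding A'_def by (rule reducible_join1)
  have "decidable_from A' (\<lambda>x. x \<in> string_code ` T)"
    using reducible_join2[of "string_code ` T" A] unfolding A'_def reducible_def .
  from computable_embedding[OF this f] obtain g where g: "embedding g" "string_computable A' g" "range g \<subseteq> T"
    by blast
  from C obtain c' where c': "c' \<in> closed_class K V" "\<And>i. ?rel (C (str i)) (c' (?h i))" by blast
  have rel: "?rel a (c' (string_code (h (g s))))" for s
    using c'(2)[of "string_code (g s)"] a[of "g s"] g(3) by auto
  show ?case
  proof (cases "a = 0")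
    case True
    then have "\<forall>s. c' (string_code (h (g s))) = b" using rel by simp
    then show ?thesis using AA' gT g c'(1) unfolding A'_def by blast
  next
    case False
    have hg: "embedding (\<lambda>s. h (g s))" "string_computable A' (\<lambda>s. h (g s))"
      using embedding_comp[OF insert.prems(3) g(1)]
        string_computable_comp[OF string_computable_reducible[OF insert.prems(4) AA'] g(2)] .
    have "\<exists>A'' g' c'' a. A' \<sqsubseteq> A'' \<and> good S A'' \<and> embedding g' \<and> string_computable A'' g' \<and>
      c'' \<in> closed_class K V \<and> (\<forall>s. c'' (string_code (h (g (g' s)))) = a)"
      using reducible_trans[OF insert.prems(1) AA'] gT[folded A'_def] hg c'(1)
      by (rule insert.IH) (use rel False in auto)
    then obtain A'' g' c'' a where 1: "A' \<sqsubseteq> A''" "good S A''" "embedding g'" "string_computable A'' g'"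
      "c'' \<in> closed_class K V" "\<forall>s. c'' (string_code (h (g (g' s)))) = a" by blast
    have "embedding (\<lambda>s. g (g' s))" "string_computable A'' (\<lambda>s. g (g' s))"
      using embedding_comp[OF g(1) 1(3)]
        string_computable_comp[OF string_computable_reducible[OF g(2) 1(1)] 1(4)] .
    then show ?thesis using reducible_trans[OF AA' 1(1)] 1 by blast
  qed
qed


section \<open>Stuck conditions\<close>

definition tail_code :: "nat \<Rightarrow> nat \<Rightarrow> nat" where "tail_code m b = (b - (2 ^ m - 1)) div 2 ^ m"
definition head_index :: "nat \<Rightarrow> nat \<Rightarrow> nat" where "head_index m b = (b - (2 ^ m - 1)) mod 2 ^ m"

lemma comp_tail_code [comp_intros]: "computable_from A f \<Longrightarrow> computable_from A (\<lambda>x. tail_code m (f x))"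
  unfolding tail_code_def by (intro comp_intros)

lemma comp_head_index [comp_intros]: "computable_from A f \<Longrightarrow> computable_from A (\<lambda>x. head_index m (f x))"
  unfolding head_index_def by (intro comp_intros)

lemma split_code:
  assumes "\<not> length s < m"
  shows "tail_code m (string_code s) = string_code (drop m s)"
    "level_string m (head_index m (string_code s)) = take m s"
proof -
  from assms have len: "length (take m s) = m" by simp
  show "tail_code m (string_code s) = string_code (drop m s)"
    using code_length_eq(2)[OF len, of "drop m s"] by (simp add: tail_code_def)
  show "level_string m (head_index m (string_code s)) = take m s"
    using code_length_eq(1)[OF len, of "drop m s"] level_string_code[OF len] by (simp add: head_index_def)
qed

text \<open>\<open>j\<close> describes, on codes, an initial part of a perfect tree that keeps the strings shorter than \<open>m\<close>.\<close>

definition initial_part :: "nat \<Rightarrow> nat \<Rightarrow> (nat \<Rightarrow> nat) \<Rightarrow> bool" where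
  "initial_part m q j \<longleftrightarrow> m \<le> q \<and> (\<forall>a<2 ^ q - 1. (a < 2 ^ m - 1 \<longrightarrow> j a = a) \<and>
     (\<not> a < 2 ^ m - 1 \<longrightarrow> \<not> j a < 2 ^ m - 1) \<and>
     (\<forall>b<2 ^ q - 1. prefix (str (j a)) (str (j b)) \<longleftrightarrow> prefix (str a) (str b)))"

definition realize :: "(bool list \<Rightarrow> bool list) \<Rightarrow> (nat \<Rightarrow> nat) \<Rightarrow> bool list \<Rightarrow> bool list" where
  "realize H j s = H (str (j (string_code s)))"

lemma part_realize: "z \<in> part q (realize H j) \<longleftrightarrow> (\<exists>a<2 ^ q - 1. string_code (H (str (j a))) = z)"
proof
  assume "z \<in> part q (realize H j)"
  then show "\<exists>a<2 ^ q - 1. string_code (H (str (j a))) = z"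
    unfolding part_def realize_def using length_less_iff by auto
next
  assume "\<exists>a<2 ^ q - 1. string_code (H (str (j a))) = z"
  then obtain a where a: "a < 2 ^ q - 1" "string_code (H (str (j a))) = z" by blast
  have "length (str a) < q" "z = string_code (realize H j (str a))"
    using a by (simp_all add: length_less_iff realize_def)
  then show "z \<in> part q (realize H j)" unfolding part_def by blast
qed

lemma part_cong: "(\<And>s. length s < q \<Longrightarrow> g s = g' s) \<Longrightarrow> part q g = part q g'"
  unfolding part_def by (auto simp: image_iff)

text \<open>
  The reservoirs of all the stuck conditions are taken from one list \<open>U\<close> of \<open>N\<close> trees, so that a number
  below \<open>2 ^ N\<close> assigns a colour to each of the trees. In \<open>win\<close>, \<open>\<gamma>\<close> is such an assignment.
\<close>

locale players =
  fixes S :: "bool list set" and D A :: "nat set" and P :: "bool list \<Rightarrow> bool"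
    and I :: "'i set" and sgn :: "'i \<Rightarrow> bool" and m :: "'i \<Rightarrow> nat"
    and H :: "'i \<Rightarrow> bool list \<Rightarrow> bool list" and e :: "'i \<Rightarrow> functional" and l :: "'i \<Rightarrow> nat"
    and N :: nat and cone :: "'i \<Rightarrow> bool list \<Rightarrow> nat" and U :: "nat \<Rightarrow> bool list \<Rightarrow> bool list"
  assumes fin: "finite I" and goodA: "good S A"
    and stuck: "\<And>i. i \<in> I \<Longrightarrow> stuck S D (\<lambda>s. P s = sgn i) A (m i) (H i) (e i) (l i)"
    and cone_less: "\<And>i t. i \<in> I \<Longrightarrow> length t = m i \<Longrightarrow> cone i t < N"
    and cone: "\<And>i t x. i \<in> I \<Longrightarrow> length t = m i \<Longrightarrow> H i (t @ x) = U (cone i t) x"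
    and win: "\<And>\<gamma> :: nat \<Rightarrow> bool. \<exists>i\<in>I. \<forall>t. length t = m i \<longrightarrow> \<gamma> (cone i t) = sgn i"
begin

abbreviation K :: nat where "K \<equiv> 2 ^ N"

text \<open>A colour below \<open>K\<close> codes a subset of the \<open>N\<close> trees: those in
  which the position in question has the colour \<open>True\<close>. One colouring thus speaks about
  all reservoirs at once.\<close>

definition coloured :: "'i \<Rightarrow> (nat \<Rightarrow> nat) \<Rightarrow> nat \<Rightarrow> (nat \<Rightarrow> nat) \<Rightarrow> bool" where
  "coloured i c q j \<longleftrightarrow> (\<forall>a<2 ^ q - 1. \<not> a < 2 ^ m i - 1 \<longrightarrow>
     (cone i (level_string (m i) (head_index (m i) (j a))) \<in> set_decode (c (tail_code (m i) (j a))) \<longleftrightarrow> sgn i))"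

text \<open>\<open>v\<close> codes the set \<open>V\<close> of the overview, and \<open>Q_V\<close>
  consists of the colourings that are not violated. The actual colouring \<open>P\<close> does not
  occur, so this class is effectively closed.\<close>

definition violated :: "nat \<Rightarrow> nat \<Rightarrow> (nat \<Rightarrow> nat) \<Rightarrow> bool" where
  "violated n v c \<longleftrightarrow> (\<exists>i\<in>I. \<exists>q j y. initial_part (m i) q j \<and> coloured i c q j \<and>
     run (e i) (join D (part q (realize (H i) j))) n = Some y \<and> set_decode y \<inter> set_decode v = {})"

lemma stuckD:
  assumes "i \<in> I"
  shows "D \<sqsubseteq> A" "embedding (H i)" "string_computable A (H i)" "condition S D (\<lambda>s. P s = sgn i) A (m i) (H i)"
  using stuck[OF assms] unfolding stuck_def condition_def by auto

text \<open>A violation has finite evidence: a finite tree, a certificate of convergence and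
  finitely many values of \<open>c\<close>. One number \<open>M\<close> bounds all of it; uniformity
  in \<open>n\<close> and \<open>v\<close> is what the final search relies on.\<close>

lemma violation_decidable:
  "\<exists>V. decidable_from A (\<lambda>p. V (p1 (p1 p)) (p2 (p1 p)) (p1 (p2 p)) (p2 (p2 p))) \<and>
    (\<forall>n v c. (\<forall>i. c i < K) \<longrightarrow> (violated n v c \<longleftrightarrow> (\<exists>M. V n v (digits K M c) M)))"
proof -
  \<comment> \<open>\<open>w\<close> is a pair of the height \<open>q\<close> and a list of the
    values of \<open>j\<close>; the oracle built from it is decidable uniformly in
    \<open>w\<close>.\<close>
  define O' where "O' i w z \<longleftrightarrow> (if odd z then \<exists>a<2 ^ p1 w - 1. string_code (H i (str (entry (p2 w) a))) = z div 2
    else z div 2 \<in> D)" for i w z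
  have O'_eq: "{z. O' i w z} = join D (part (p1 w) (realize (H i) (entry (p2 w))))" for i w
    by (auto simp: O'_def mem_join part_realize)
  have "\<exists>F. computable_from A (\<lambda>p. F (p1 p) (p1 (p2 p)) (p2 (p2 p))) \<and>
    (\<forall>w n y. run (e i) {z. O' i w z} n = Some y \<longleftrightarrow> (\<exists>s. F w n s = Suc y))" if i: "i \<in> I" for i
  proof (rule run_certificate)
    have 1: "decidable_from A (\<lambda>p. p2 p div 2 \<in> D)"
      by (rule dec_compose[of A "\<lambda>x. x \<in> D"])
        (use stuckD(1)[OF i] in \<open>auto simp: reducible_def intro!: comp_intros\<close>)
    have 2: "computable_from A (\<lambda>p. string_code (H i (str (entry (p2 (p1 (p1 p))) (p2 p)))))"
      by (rule comp_compose[OF stuckD(3)[OF i, unfolded string_computable_def]]) (intro comp_intros)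
    show "decidable_from A (\<lambda>p. O' i (p1 p) (p2 p))"
      unfolding O'_def by (intro 1 2 comp_intros)
  qed
  then have "\<forall>i\<in>I. \<exists>F. computable_from A (\<lambda>p. F (p1 p) (p1 (p2 p)) (p2 (p2 p))) \<and>
    (\<forall>w n y. run (e i) {z. O' i w z} n = Some y \<longleftrightarrow> (\<exists>s. F w n s = Suc y))" by blast
  from bchoice[OF this] obtain F where
    F': "\<forall>i\<in>I. computable_from A (\<lambda>p. F i (p1 p) (p1 (p2 p)) (p2 (p2 p))) \<and>
      (\<forall>w n y. run (e i) {z. O' i w z} n = Some y \<longleftrightarrow> (\<exists>s. F i w n s = Suc y))" ..
  then have F: "computable_from A (\<lambda>p. F i (p1 p) (p1 (p2 p)) (p2 (p2 p)))"
    "run (e i) {z. O' i w z} n = Some y \<longleftrightarrow> (\<exists>s. F i w n s = Suc y)" if "i \<in> I" for i w n y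
    using that by blast+
  define G where "G i x = (if x < 2 ^ m i then cone i (level_string (m i) x) else 0)" for i x
  \<comment> \<open>The last clause expresses disjointness by a bounded quantifier: elements of a
    decoded set are smaller than its code.\<close>
  define X where "X i n v r M w s \<longleftrightarrow> initial_part (m i) (p1 w) (entry (p2 w)) \<and>
    (\<forall>a<2 ^ p1 w - 1. \<not> a < 2 ^ m i - 1 \<longrightarrow> tail_code (m i) (entry (p2 w) a) < M \<and>
      (G i (head_index (m i) (entry (p2 w) a)) \<in> set_decode (digit K r (tail_code (m i) (entry (p2 w) a))) \<longleftrightarrow> sgn i)) \<and>
    0 < F i w n s \<and> (\<forall>x<F i w n s. \<not> (x \<in> set_decode (F i w n s - 1) \<and> x \<in> set_decode v))" for i n v r M w s
  define V where "V n v r M \<longleftrightarrow> (\<exists>w<M. \<exists>s<M. \<exists>i\<in>I. X i n v r M w s)" for n v r M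
  have GC: "computable_from A (G i)" for i
    unfolding G_def by (rule comp_cases[where f = "\<lambda>x _. cone i (level_string (m i) x)", OF comp_const comp_id comp_id])
  have "decidable_from A (\<lambda>p. V (p1 (p1 p)) (p2 (p1 p)) (p1 (p2 p)) (p2 (p2 p)))"
    unfolding V_def
  proof (rule dec_bex, goal_cases)
    case 2
    show ?case
    proof (rule dec_bex, goal_cases)
      case 2
      show ?case
      proof (rule dec_fin_bex[OF fin])
        fix i assume i: "i \<in> I"
        have FC: "computable_from A (\<lambda>x. F i (f x) (g x) (h x))"
          if "computable_from A f" "computable_from A g" "computable_from A h" for f g h
          using comp_compose[OF F(1)[OF i] comp_pair[OF that(1) comp_pair[OF that(2,3)]]] by simp
        show "decidable_from A (\<lambda>p. X i (p1 (p1 (p1 (p1 p)))) (p2 (p1 (p1 (p1 p)))) (p1 (p2 (p1 (p1 p))))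
          (p2 (p2 (p1 (p1 p)))) (p2 (p1 p)) (p2 p))"
          unfolding X_def initial_part_def by (intro FC comp_compose[OF GC] comp_intros)
      qed
    qed (intro comp_intros)
  qed (intro comp_intros)
  moreover have "violated n v c \<longleftrightarrow> (\<exists>M. V n v (digits K M c) M)" if c: "\<forall>i. c i < K" for n v c
  proof
    assume "\<exists>M. V n v (digits K M c) M"
    then obtain M w s i where i: "i \<in> I" and X: "X i n v (digits K M c) M w s"
      unfolding V_def by blast
    let ?q = "p1 w" and ?j = "entry (p2 w)" and ?y = "F i w n s - 1"
    have "coloured i c ?q ?j" unfolding coloured_def
    proof (intro allI impI)
      fix a :: nat assume a: "a < 2 ^ ?q - 1" "\<not> a < 2 ^ m i - 1"
      with X have t: "tail_code (m i) (?j a) < M"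
        "G i (head_index (m i) (?j a)) \<in> set_decode (digit K (digits K M c) (tail_code (m i) (?j a))) \<longleftrightarrow> sgn i"
        unfolding X_def by blast+
      have "digit K (digits K M c) (tail_code (m i) (?j a)) = c (tail_code (m i) (?j a))"
        using c t(1) by (intro digit_digits) auto
      with t(2) show "cone i (level_string (m i) (head_index (m i) (?j a))) \<in> set_decode (c (tail_code (m i) (?j a))) \<longleftrightarrow> sgn i"
        by (simp add: G_def head_index_def)
    qed
    moreover have "initial_part (m i) ?q ?j" using X unfolding X_def by blast
    moreover have "run (e i) (join D (part ?q (realize (H i) ?j))) n = Some ?y"
    proof -
      have "F i w n s = Suc ?y" using X unfolding X_def by simp
      then show ?thesis using F(2)[OF i, of w n ?y] unfolding O'_eq by blast
    qed
    moreover have "set_decode ?y \<inter> set_decode v = {}"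
    proof -
      have "x < F i w n s" if "x \<in> set_decode ?y" for x using set_decode_less[OF that] by simp
      then show ?thesis using X unfolding X_def by blast
    qed
    ultimately show "violated n v c" unfolding violated_def using i by blast
  next
    assume "violated n v c"
    then obtain i q j y where i: "i \<in> I" and j: "initial_part (m i) q j" "coloured i c q j"
      and y: "run (e i) (join D (part q (realize (H i) j))) n = Some y" "set_decode y \<inter> set_decode v = {}"
      unfolding violated_def by blast
    obtain x where x: "\<And>a. a < 2 ^ q - 1 \<Longrightarrow> entry x a = j a" using ex_entry[of "2 ^ q - 1" j] by blast
    define w where "w = prod_encode (q, x)"
    have w: "p1 w = q" "p2 w = x" by (simp_all add: w_def)
    have "part q (realize (H i) j) = part q (realize (H i) (entry x))"
      by (rule part_cong) (simp add: realize_def x length_less_iff)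
    with y(1) obtain s where s: "F i w n s = Suc y" using F(2)[OF i, of w n y] unfolding O'_eq w by metis
    define M where "M = Suc (w + s + (\<Sum>a<2 ^ q - 1. tail_code (m i) (j a)))"
    have tM: "tail_code (m i) (j a) < M" if "a < 2 ^ q - 1" for a :: nat
    proof -
      have "tail_code (m i) (j a) \<le> (\<Sum>a<2 ^ q - 1. tail_code (m i) (j a))"
        using that by (intro member_le_sum) auto
      then show ?thesis unfolding M_def by simp
    qed
    have dig: "digit K (digits K M c) (tail_code (m i) (j a)) = c (tail_code (m i) (j a))" if "a < 2 ^ q - 1" for a :: nat
      using c tM[OF that] by (intro digit_digits) auto
    have "X i n v (digits K M c) M w s"
      unfolding X_def w s
    proof (intro conjI allI impI)
      show "initial_part (m i) q (entry x)" using j(1) x unfolding initial_part_def by simp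
    next
      fix a :: nat assume a: "a < 2 ^ q - 1" "\<not> a < 2 ^ m i - 1"
      show "tail_code (m i) (entry x a) < M" using tM a x by simp
      show "G i (head_index (m i) (entry x a)) \<in> set_decode (digit K (digits K M c) (tail_code (m i) (entry x a))) \<longleftrightarrow> sgn i"
        using j(2) a dig[OF a(1)] x[OF a(1)] by (simp add: coloured_def G_def head_index_def)
    qed (use y(2) in auto)
    moreover have "w < M" "s < M" by (simp_all add: M_def)
    ultimately show "\<exists>M. V n v (digits K M c) M" unfolding V_def using i by blast
  qed
  ultimately show ?thesis by (intro exI[of _ V]) blast
qed

text \<open>For the colouring read off from \<open>P\<close>, a violation would be an extension with
  correct colours whose value misses \<open>S\<close> at level \<open>n\<close>, and
  \<open>stuck_no_wrong_value\<close> excludes this.\<close>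

lemma true_colouring_not_violated:
  assumes v: "set_decode v = level_codes S n"
  shows "\<exists>c. (\<forall>i. c i < K) \<and> \<not> violated n v c"
proof (intro exI conjI)
  define c where "c i = set_encode {x. x < N \<and> P (U x (str i))}" for i
  show "\<forall>i. c i < K" unfolding c_def by (auto intro: set_encode_less)
  show "\<not> violated n v c"
  proof
    assume "violated n v c"
    then obtain i q j y where i: "i \<in> I" and j: "initial_part (m i) q j" "coloured i c q j"
      and y: "run (e i) (join D (part q (realize (H i) j))) n = Some y" "set_decode y \<inter> set_decode v = {}"
      unfolding violated_def by blast
    from j(1) have j1: "m i \<le> q" "\<And>a. a < 2 ^ q - 1 \<Longrightarrow> a < 2 ^ m i - 1 \<Longrightarrow> j a = a"
      "\<And>a. a < 2 ^ q - 1 \<Longrightarrow> \<not> a < 2 ^ m i - 1 \<Longrightarrow> \<not> j a < 2 ^ m i - 1"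
      "\<And>a b. a < 2 ^ q - 1 \<Longrightarrow> b < 2 ^ q - 1 \<Longrightarrow> prefix (str (j a)) (str (j b)) \<longleftrightarrow> prefix (str a) (str b)"
      unfolding initial_part_def by auto
    have short: "realize (H i) j s = H i s" if "length s < m i" for s
    proof -
      have "length s < q" using that j1(1) by simp
      then show ?thesis using that j1(2)[of "string_code s"] by (simp add: realize_def length_less_iff)
    qed
    show False
    proof (rule stuck_no_wrong_value[OF stuck[OF i] _ _ y(1) y(2)[unfolded v]])
      show "finite_extension (m i) (H i) q (realize (H i) j)"
        unfolding finite_extension_def
      proof (intro conjI allI impI)
        fix s t :: "bool list" assume "length s < q" "length t < q"
        then show "prefix (realize (H i) j s) (realize (H i) j t) \<longleftrightarrow> prefix s t"
          using j1(4)[of "string_code s" "string_code t"] stuckD(2)[OF i]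
          by (simp add: realize_def embedding_def length_less_iff)
      qed (use j1(1) short in \<open>auto simp: realize_def\<close>)
      fix s :: "bool list" assume s: "length s < q"
      let ?a = "string_code s"
      show "P (realize (H i) j s) = sgn i"
      proof (cases "length s < m i")
        case True
        then show ?thesis using short stuckD(4)[OF i] by (simp add: condition_def)
      next
        case False
        define t where "t = str (j ?a)"
        have "\<not> length t < m i" using j1(3)[of ?a] s False by (simp add: t_def length_less_iff)
        then have t: "length (take (m i) t) = m i" by simp
        have "j ?a = string_code t" by (simp add: t_def)
        then have "cone i (take (m i) t) \<in> set_decode (c (string_code (drop (m i) t))) \<longleftrightarrow> sgn i"
          using j(2) s False split_code[OF \<open>\<not> length t < m i\<close>]
          unfolding coloured_def by (auto simp: length_less_iff)
        then have "P (U (cone i (take (m i) t)) (drop (m i) t)) \<longleftrightarrow> sgn i"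
          using cone_less[OF i t] by (simp add: c_def)
        then show ?thesis using cone[OF i t, of "drop (m i) t"] by (simp add: realize_def t_def)
      qed
    qed
  qed
qed

text \<open>All reservoirs of condition \<open>i\<close> are thinned by the same \<open>h\<close>.
  As the condition is stuck, some finite extension in them yields a value \<open>y\<close> of size
  at most \<open>l i\<close>. It is coloured correctly for all the given \<open>c\<close> at once,
  so \<open>y\<close> meets each \<open>v\<close> in \<open>Y\<close>; otherwise the
  \<open>c\<close> belonging to \<open>v\<close> would be violated.\<close>

lemma homogeneous_not_violated:
  assumes AA': "A \<sqsubseteq> A'" "good S A'" and h: "embedding h" "string_computable A' h"
    and i: "i \<in> I"
    and Y: "\<And>v. v \<in> Y \<Longrightarrow> \<exists>c a. \<not> violated n v c \<and> (\<forall>s. c (string_code (h s)) = a) \<and>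
      (\<forall>t. length t = m i \<longrightarrow> (cone i t \<in> set_decode a \<longleftrightarrow> sgn i))"
  shows "\<exists>y. card (set_decode y) \<le> l i \<and> (\<forall>v\<in>Y. set_decode y \<inter> set_decode v \<noteq> {})"
proof -
  define J where "J = glue (m i) (\<lambda>s. s) (\<lambda>t x. t @ h x)"
  have hemb: "prefix (h x) (h y) \<longleftrightarrow> prefix x y" for x y using h(1) by (simp add: embedding_def)
  have J: "embedding J" unfolding J_def
  proof (rule embedding_glue)
    show "prefix s (t @ h x) \<longleftrightarrow> prefix s t" if "length s < m i" "length t = m i" for s t x
      using that by (auto simp: prefix_append)
    show "\<not> prefix (t @ h x) s" if "length s < m i" "length t = m i" for s t x
      using that by (auto dest: prefix_length_le)
    show "t = t'" if "length t = m i" "length t' = m i" "prefix (t @ h x) (t' @ h y)" for t t' x y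
      using that by (auto elim!: prefixE)
    show "embedding (\<lambda>x. t @ h x)" for t by (simp add: embedding_def hemb)
  qed simp
  have Jc: "string_computable A' J" unfolding J_def
    using string_computable_comp[OF string_computable_append h(2)] by (intro string_computable_glue)
  note He = stuckD(2)[OF i] and Hc = string_computable_reducible[OF stuckD(3)[OF i] AA'(1)]
  define H' where "H' s = H i (J s)" for s
  have H': "embedding H'" "string_computable A' H'"
    unfolding H'_def using embedding_comp[OF He J] string_computable_comp[OF Hc Jc] .
  have J_short: "J s = s" if "length s < m i" for s using that by (simp add: J_def glue_def)
  have "condition S D (\<lambda>s. P s = sgn i) A' (m i) H'"
    using H' J_short AA'(2) reducible_trans[OF stuckD(1)[OF i] AA'(1)] stuckD(4)[OF i]
    by (simp add: condition_def) (simp add: H'_def)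
  moreover have "extends (m i) (H i) (m i) H'"
    using J_short by (auto simp: extends_def H'_def)
  ultimately have "\<not> forces S D (m i) H' (e i) (l i) n"
    using stuck[OF i] AA'(1) unfolding stuck_def by blast
  then obtain q g y where g: "finite_extension (m i) H' q g"
    and y: "run (e i) (join D (part q g)) n = Some y" "card (set_decode y) \<le> l i"
    unfolding forces_def hits_def by blast
  from g have g1: "m i \<le> q" "\<And>s. length s < m i \<Longrightarrow> g s = H' s"
    "\<And>s t. length s < q \<Longrightarrow> length t < q \<Longrightarrow> prefix (g s) (g t) \<longleftrightarrow> prefix s t"
    and "\<And>s. length s < q \<Longrightarrow> \<exists>r. g s = H' r"
    unfolding finite_extension_def by auto
  then obtain r where r: "\<And>s. length s < q \<Longrightarrow> g s = H' (r s)" by metis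
  \<comment> \<open>\<open>r\<close> locates the extension in the thinned tree, and \<open>J\<close>
    carries it to positions in \<open>H i\<close>, where violation is expressed.\<close>
  define j where "j a = string_code (J (r (str a)))" for a
  have rinc: "prefix (r s) (r t) \<longleftrightarrow> prefix s t" if "length s < q" "length t < q" for s t
    using g1(3)[OF that] r[OF that(1)] r[OF that(2)] H'(1) by (simp add: embedding_def)
  have r_short: "r s = s" if "length s < m i" for s
    using g1(1) g1(2)[OF that] r[of s] that embedding_inj[OF H'(1)] by simp
  \<comment> \<open>The positions shorter than \<open>m i\<close> are taken by the fixed strings,
    and \<open>r\<close> is injective.\<close>
  have r_long: "\<not> length (r s) < m i" if s: "length s < q" "\<not> length s < m i" for s
  proof
    assume a: "length (r s) < m i"
    then have "r (r s) = r s" "length (r s) < q" using r_short g1(1) by auto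
    then have "r s = s" using rinc[of s "r s"] rinc[of "r s" s] s(1) by (simp add: prefix_order.eq_iff)
    with a s(2) show False by simp
  qed
  have J_long: "\<not> length (J s) < m i" "take (m i) (J s) = take (m i) s" "drop (m i) (J s) = h (drop (m i) s)"
    if "\<not> length s < m i" for s
    using that by (simp_all add: J_def glue_def)
  have str_len: "a < 2 ^ k - 1 \<longleftrightarrow> length (str a) < k" for a k by (simp add: length_less_iff)
  have ip: "initial_part (m i) q j" unfolding initial_part_def str_len
  proof (intro conjI allI impI)
    fix a assume a: "length (str a) < q"
    show "j a = a" if "length (str a) < m i" using that by (simp add: j_def r_short J_short)
    show "\<not> length (str (j a)) < m i" if "\<not> length (str a) < m i"
      using J_long(1)[OF r_long[OF a that]] by (simp add: j_def)
    fix b assume "length (str b) < q"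
    with a show "prefix (str (j a)) (str (j b)) \<longleftrightarrow> prefix (str a) (str b)"
      using J rinc by (simp add: j_def embedding_def)
  qed (rule g1(1))
  have "part q g = part q (realize (H i) j)"
    by (rule part_cong) (simp add: realize_def j_def r H'_def)
  with y(1) have run: "run (e i) (join D (part q (realize (H i) j))) n = Some y" by simp
  have "set_decode y \<inter> set_decode v \<noteq> {}" if v: "v \<in> Y" for v
  proof
    assume "set_decode y \<inter> set_decode v = {}"
    obtain c a where c: "\<not> violated n v c" "\<And>s. c (string_code (h s)) = a"
      "\<And>t. length t = m i \<Longrightarrow> cone i t \<in> set_decode a \<longleftrightarrow> sgn i"
      using Y[OF v] by blast
    have "coloured i c q j" unfolding coloured_def str_len
    proof (intro allI impI)
      fix b assume b: "length (str b) < q" "\<not> length (str b) < m i"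
      note L = J_long[OF r_long[OF b]]
      have "c (tail_code (m i) (j b)) = a" unfolding j_def split_code(1)[OF L(1)] L(3) by (rule c(2))
      moreover have "level_string (m i) (head_index (m i) (j b)) = take (m i) (r (str b))"
        unfolding j_def split_code(2)[OF L(1)] L(2) ..
      moreover have "length (take (m i) (r (str b))) = m i" using r_long[OF b] by simp
      ultimately show "cone i (level_string (m i) (head_index (m i) (j b))) \<in> set_decode (c (tail_code (m i) (j b))) \<longleftrightarrow> sgn i"
        using c(3) by simp
    qed
    then have "violated n v c"
      unfolding violated_def using i ip run \<open>set_decode y \<inter> set_decode v = {}\<close> by blast
    with c(1) show False ..
  qed
  then show ?thesis using y(2) by blast
qed

text \<open>Hitting sets of a size independent of \<open>n\<close> exist for the nonempty classes,
  and a search finds suitable sets without deciding which classes are nonempty.\<close>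

lemma contradiction:
  assumes av: "Pi01_class_avoidance k" "k \<ge> 2"
  shows False
proof -
  obtain V where V: "decidable_from A (\<lambda>p. V (p1 (p1 p)) (p2 (p1 p)) (p1 (p2 p)) (p2 (p2 p)))"
    and viol: "\<And>n v c. (\<forall>i. c i < K) \<Longrightarrow> violated n v c \<longleftrightarrow> (\<exists>M. V n v (digits K M c) M)"
    using violation_decidable by blast
  have mem: "c \<in> closed_class K (V n v) \<longleftrightarrow> (\<forall>i. c i < K) \<and> \<not> violated n v c" for n v c
    unfolding closed_class_def using viol by blast
  \<comment> \<open>Strings of length at most \<open>n\<close> have codes below
    \<open>2 ^ Suc n\<close>, so sets of them, the level of \<open>S\<close> included, are coded
    below \<open>2 ^ 2 ^ Suc n\<close>.\<close>
  define F where "F n = {v. v < 2 ^ 2 ^ Suc n \<and> closed_class K (V n v) \<noteq> {}}" for n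
  define L where "L = sum l I"
  have finF: "finite (F n)" for n unfolding F_def by simp
  have VC: "decidable_from A (\<lambda>x. V (f x) (g x) (r x) (M x))"
    if "computable_from A f" "computable_from A g" "computable_from A r" "computable_from A M" for f g r M
    using dec_compose[OF V comp_pair[OF comp_pair[OF that(1,2)] comp_pair[OF that(3,4)]]] by simp

  have hitting: "\<exists>x. card (set_decode x) \<le> L \<and> (\<forall>v\<in>F n. set_decode x \<inter> set_decode v \<noteq> {})" for n
  proof -
    \<comment> \<open>The finitely many classes are treated one after another on the same tree;
      constancy of the earlier members survives further thinning.\<close>
    have "\<exists>A' h. A \<sqsubseteq> A' \<and> good S A' \<and> embedding h \<and> string_computable A' h \<and>
      (\<forall>v\<in>X. \<exists>c a. c \<in> closed_class K (V n v) \<and> (\<forall>s. c (string_code (h s)) = a))" if "finite X" "X \<subseteq> F n" for X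
      using that
    proof (induction X)
      case empty
      show ?case using reducible_refl goodA embedding_id string_computable_id by blast
    next
      case (insert v X)
      then obtain A' h where 1: "A \<sqsubseteq> A'" "good S A'" "embedding h" "string_computable A' h"
        "\<forall>v\<in>X. \<exists>c a. c \<in> closed_class K (V n v) \<and> (\<forall>s. c (string_code (h s)) = a)" by blast
      obtain c where c: "c \<in> closed_class K (V n v)" using insert.prems by (auto simp: F_def)
      have "decidable_from A (\<lambda>p. V n v (p1 p) (p2 p))" by (intro VC comp_intros)
      from homogeneous_embedding[OF av this finite_lessThan 1(1-4) c, of K] c obtain A'' g c' a where
        2: "A' \<sqsubseteq> A''" "good S A''" "embedding g" "string_computable A'' g"
          "c' \<in> closed_class K (V n v)" "\<forall>s. c' (string_code (h (g s))) = a"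
        unfolding closed_class_def by blast
      have "embedding (\<lambda>s. h (g s))" "string_computable A'' (\<lambda>s. h (g s))"
        using embedding_comp[OF 1(3) 2(3)]
          string_computable_comp[OF string_computable_reducible[OF 1(4) 2(1)] 2(4)] .
      moreover have "\<forall>v\<in>insert v X. \<exists>c a. c \<in> closed_class K (V n v) \<and> (\<forall>s. c (string_code (h (g s))) = a)"
        using 1(5) 2(5,6) by (metis insert_iff)
      ultimately show ?case using reducible_trans[OF 1(1) 2(1)] 2(2) by blast
    qed
    from this[OF finF order_refl] obtain A' h where
      1: "A \<sqsubseteq> A'" "good S A'" "embedding h" "string_computable A' h"
      "\<forall>v\<in>F n. \<exists>c a. c \<in> closed_class K (V n v) \<and> (\<forall>s. c (string_code (h s)) = a)" by blast
    then obtain c a where ca: "\<And>v. v \<in> F n \<Longrightarrow> c v \<in> closed_class K (V n v)"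
      "\<And>v s. v \<in> F n \<Longrightarrow> c v (string_code (h s)) = a v" by metis
    \<comment> \<open>\<open>w v\<close> is a condition that accepts the homogeneous colour
      \<open>a v\<close>. The sets \<open>v\<close> are divided among the conditions accordingly,
      and each group is met by one set of size at most \<open>l i\<close>.\<close>
    obtain w where w: "\<And>v. w v \<in> I" "\<And>v t. length t = m (w v) \<Longrightarrow> (cone (w v) t \<in> set_decode (a v)) = sgn (w v)"
      using win[of "\<lambda>x. x \<in> set_decode (a v)" for v] by metis
    have "\<exists>y. card (set_decode y) \<le> l i \<and> (\<forall>v\<in>{v \<in> F n. w v = i}. set_decode y \<inter> set_decode v \<noteq> {})"
      if "i \<in> I" for i
    proof (rule homogeneous_not_violated[OF 1(1-4) that])
      fix v assume v: "v \<in> {v \<in> F n. w v = i}"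
      then have "\<not> violated n v (c v)" using ca(1)[of v] by (simp add: mem)
      then show "\<exists>c a. \<not> violated n v c \<and> (\<forall>s. c (string_code (h s)) = a) \<and>
        (\<forall>t. length t = m i \<longrightarrow> (cone i t \<in> set_decode a \<longleftrightarrow> sgn i))"
        using ca(2) w(2) v by blast
    qed
    then obtain y where y: "\<And>i. i \<in> I \<Longrightarrow> card (set_decode (y i)) \<le> l i"
      "\<And>i v. i \<in> I \<Longrightarrow> v \<in> F n \<Longrightarrow> w v = i \<Longrightarrow> set_decode (y i) \<inter> set_decode v \<noteq> {}" by (metis (mono_tags, lifting) mem_Collect_eq)
    let ?W = "\<Union>i\<in>I. set_decode (y i)"
    have finW: "finite ?W" using fin by simp
    have "card ?W \<le> (\<Sum>i\<in>I. card (set_decode (y i)))" by (rule card_UN_le[OF fin])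
    also have "\<dots> \<le> L" unfolding L_def using y(1) by (rule sum_mono)
    finally have "card ?W \<le> L" .
    moreover have "?W \<inter> set_decode v \<noteq> {}" if "v \<in> F n" for v using y(2)[OF w(1) that refl] w(1) by blast
    ultimately show ?thesis using finW by (intro exI[of _ "set_encode ?W"]) simp
  qed

  \<comment> \<open>\<open>p1 z\<close> is a stage and \<open>p2 z\<close> a candidate. Each
    \<open>v\<close> must be met by the candidate or have its class seen empty at that stage, no
    segment having survived.\<close>
  define Z where "Z n z \<longleftrightarrow> card (set_decode (p2 z)) \<le> L \<and> (\<forall>v<2 ^ 2 ^ Suc n.
    (\<forall>r<K ^ p1 z. \<exists>M<Suc (p1 z). V n v (r mod K ^ M) M) \<or> (\<exists>i<p2 z. i \<in> set_decode (p2 z) \<and> i \<in> set_decode v))" for n z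
  have Z_comp: "decidable_from A (\<lambda>p. Z (p1 p) (p2 p))"
    unfolding Z_def by (intro VC comp_intros)
  have Z_ex: "\<exists>z. Z n z" for n
  proof -
    obtain x where x: "card (set_decode x) \<le> L" "\<And>v. v \<in> F n \<Longrightarrow> set_decode x \<inter> set_decode v \<noteq> {}"
      using hitting by blast
    \<comment> \<open>By compactness an empty class is refuted at a finite stage.\<close>
    have empty: "\<exists>T. \<forall>r. \<exists>M<Suc T. V n v (r mod K ^ M) M" if "v < 2 ^ 2 ^ Suc n" "v \<notin> F n" for v
    proof (rule ccontr)
      assume neg: "\<not> ?thesis"
      have "\<exists>c. (\<forall>i. c i < K) \<and> (\<forall>T. \<forall>M<Suc T. \<not> V n v (digits K M c) M)"
      proof (rule bounded_compactness)
        fix T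
        obtain r where r: "\<forall>M<Suc T. \<not> V n v (r mod K ^ M) M" using neg by blast
        have "\<forall>i. digit K r i < K" by (simp add: digit_def)
        moreover have "\<forall>M<Suc T. \<not> V n v (digits K M (digit K r)) M" using r by (simp add: digits_digit)
        ultimately show "\<exists>c. (\<forall>i. c i < K) \<and> (\<forall>M<Suc T. \<not> V n v (digits K M c) M)" by blast
      next
        fix T c d
        assume "\<forall>i<T. c i = d i" and c: "\<forall>M<Suc T. \<not> V n v (digits K M c) M"
        then have "digits K M c = digits K M d" if "M < Suc T" for M
          using that by (intro digits_cong) auto
        with c show "\<forall>M<Suc T. \<not> V n v (digits K M d) M" by metis
      qed auto
      then obtain c where "c \<in> closed_class K (V n v)" unfolding closed_class_def by blast
      with that show False unfolding F_def by blast
    qed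
    then obtain T where T: "\<And>v r. v < 2 ^ 2 ^ Suc n \<Longrightarrow> v \<notin> F n \<Longrightarrow> \<exists>M<Suc (T v). V n v (r mod K ^ M) M"
      by metis
    define T' where "T' = (\<Sum>v<2 ^ 2 ^ Suc n. T v)"
    have T': "T v \<le> T'" if "v < 2 ^ 2 ^ Suc n" for v
      unfolding T'_def using that by (intro member_le_sum) auto
    have "Z n (prod_encode (T', x))" unfolding Z_def
    proof (intro conjI allI impI)
      fix v :: nat assume v: "v < 2 ^ 2 ^ Suc n"
      show "(\<forall>r<K ^ p1 (prod_encode (T', x)). \<exists>M<Suc (p1 (prod_encode (T', x))). V n v (r mod K ^ M) M) \<or>
        (\<exists>i<p2 (prod_encode (T', x)). i \<in> set_decode (p2 (prod_encode (T', x))) \<and> i \<in> set_decode v)"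
      proof (cases "v \<in> F n")
        case True
        with x(2) obtain i where "i \<in> set_decode x" "i \<in> set_decode v" by blast
        then show ?thesis using set_decode_less by auto
      next
        case False
        have "\<exists>M<Suc T'. V n v (r mod K ^ M) M" for r
          using T[OF v False, of r] T'[OF v] by (meson Suc_le_mono less_le_trans)
        then show ?thesis by simp
      qed
    qed (use x(1) in simp)
    then show ?thesis ..
  qed
  define z where "z n = (LEAST z. Z n z)" for n
  have z: "Z n (z n)" for n unfolding z_def by (rule LeastI_ex[OF Z_ex])
  have "computable_from A z" unfolding z_def by (rule comp_Least[OF Z_comp Z_ex])
  then have "computable_from A (\<lambda>n. p2 (z n))" by (rule comp_snd)
  moreover have "card (set_decode (p2 (z n))) \<le> L" for n using z[of n] unfolding Z_def by blast
  moreover have "set_decode (p2 (z n)) \<inter> level_codes S n \<noteq> {}" for n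
  proof -
    define v where "v = set_encode (level_codes S n)"
    have sub: "level_codes S n \<subseteq> {..<2 ^ Suc n}"
    proof
      fix x assume "x \<in> level_codes S n"
      then obtain s where "x = string_code s" "length s < Suc n" by (auto simp: level_codes_def)
      then have "x < 2 ^ Suc n - 1" using length_less_iff by blast
      then show "x \<in> {..<2 ^ Suc n}" by simp
    qed
    then have v: "v < 2 ^ 2 ^ Suc n" unfolding v_def by (rule set_encode_less)
    have sv: "set_decode v = level_codes S n" unfolding v_def using finite_subset[OF sub] by simp
    \<comment> \<open>The true colouring survives every stage, so for the level of \<open>S\<close>
      the alternative of an empty class is ruled out and the candidate meets it.\<close>
    from true_colouring_not_violated[OF sv] obtain c where c: "\<forall>i. c i < K" "\<not> violated n v c" by blast
    have "digits K (p1 (z n)) c < K ^ p1 (z n)" using c(1) by (intro digits_less) auto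
    moreover have "\<not> V n v (digits K (p1 (z n)) c mod K ^ M) M" if "M < Suc (p1 (z n))" for M
    proof -
      have "digits K (p1 (z n)) c mod K ^ M = digits K M c" using c(1) that by (intro digits_mod) auto
      then show ?thesis using c viol by metis
    qed
    ultimately obtain i where "i \<in> set_decode (p2 (z n))" "i \<in> set_decode v"
      using z[of n] v unfolding Z_def by blast
    then show ?thesis using sv by blast
  qed
  ultimately have "\<not> good S A" by (rule not_goodI)
  with goodA show False by blast
qed

end


text \<open>All these conditions must share one oracle. It grows as further strings are treated, and
  a stuck condition remains stuck over a larger good oracle.\<close>

lemma stuck_in_subtrees:
  assumes ns: "\<And>b :: bool. \<not> solvable S D (\<lambda>s. P s = b)"
    and H: "condition S D Q A m H" and X: "finite X"
  shows "\<exists>A' mm HH ee ll. A \<sqsubseteq> A' \<and> good S A' \<and> (\<forall>t\<in>X. stuck S D (\<lambda>s. P s = b) A' (mm t) (HH t) (ee t) (ll t) \<and>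
    range (HH t) \<subseteq> range (\<lambda>x. H (t @ x)))"
  using X
proof (induction X)
  case empty
  then show ?case using H reducible_refl unfolding condition_def by blast
next
  case (insert t X)
  then obtain A' mm HH ee ll where 1: "A \<sqsubseteq> A'" "good S A'"
    "\<forall>t\<in>X. stuck S D (\<lambda>s. P s = b) A' (mm t) (HH t) (ee t) (ll t) \<and> range (HH t) \<subseteq> range (\<lambda>x. H (t @ x))"
    by blast
  \<comment> \<open>The cone above \<open>t\<close> is taken with empty finite part, so the change
    of colour from \<open>Q\<close> to \<open>b\<close> costs nothing.\<close>
  have c: "condition S D (\<lambda>s. P s = b) A' 0 (\<lambda>x. H (t @ x))"
    using H 1(1,2) reducible_trans[of D A A'] embedding_comp[OF _ embedding_append]
      string_computable_comp[OF string_computable_reducible[OF _ 1(1)] string_computable_append]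
    unfolding condition_def by auto
  have n: "\<not> solvable S D (\<lambda>s. \<not> P s = b)" using ns[of "\<not> b"] by (cases b) auto
  obtain A'' m' H' e l where 2: "A' \<sqsubseteq> A''" "extends 0 (\<lambda>x. H (t @ x)) m' H'"
    "stuck S D (\<lambda>s. P s = b) A'' m' H' e l"
    by (rule ex_stuck[OF c ns n])
  have good: "good S A''" using 2(3) unfolding stuck_def condition_def by blast
  have "range H' \<subseteq> range (\<lambda>x. H (t @ x))" using 2(2) unfolding extends_def by blast
  moreover have "stuck S D (\<lambda>s. P s = b) A'' (mm t') (HH t') (ee t') (ll t')" if "t' \<in> X" for t'
    using 1(3) that stuck_reducible[OF _ 2(1) good] by blast
  ultimately have "\<forall>t'\<in>insert t X. stuck S D (\<lambda>s. P s = b) A'' ((mm(t := m')) t') ((HH(t := H')) t')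
      ((ee(t := e)) t') ((ll(t := l)) t') \<and> range ((HH(t := H')) t') \<subseteq> range (\<lambda>x. H (t' @ x))"
    using 1(3) 2(3) insert.hyps by auto
  then show ?case using reducible_trans[OF 1(1) 2(1)] good by blast
qed

text \<open>
  A stuck condition for \<open>P\<close> is fixed, and in each of its cones a stuck condition for the complement of
  \<open>P\<close>. A colouring of the cones of the latter makes one of them wholly of colour \<open>False\<close>, or else it
  makes a cone of each of them wholly of colour \<open>True\<close>, and these cones together form a stuck condition for \<open>P\<close>.
\<close>

lemma solvable_or_complement:
  assumes av: "Pi01_class_avoidance k" "k \<ge> 2" and good: "good S D"
  shows "solvable S D P \<or> solvable S D (\<lambda>s. \<not> P s)"
proof (rule ccontr)
  assume "\<not> ?thesis"
  then have ns: "\<not> solvable S D (\<lambda>s. P s = b)" for b by (cases b) auto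
  have c: "condition S D (\<lambda>s. P s = True) D 0 (\<lambda>s. s)"
    using good reducible_refl embedding_id string_computable_id unfolding condition_def by simp
  have n: "\<not> solvable S D (\<lambda>s. \<not> P s = True)" using ns[of False] by simp
  obtain A1 m1 H1 e1 l1 where st1: "stuck S D (\<lambda>s. P s = True) A1 m1 H1 e1 l1"
    by (rule ex_stuck[OF c ns n])
  define lev where "lev n = {s :: bool list. length s = n}" for n
  have c1: "condition S D (\<lambda>s. P s = True) A1 m1 H1" using st1 unfolding stuck_def by blast
  from stuck_in_subtrees[OF ns c1 finite_length_eq[of m1], of False]
  obtain A mm HH ee ll where A: "A1 \<sqsubseteq> A" "good S A" and
    "\<forall>t\<in>{t. length t = m1}. stuck S D (\<lambda>s. P s = False) A (mm t) (HH t) (ee t) (ll t) \<and>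
      range (HH t) \<subseteq> range (\<lambda>x. H1 (t @ x))"
    by blast
  then have HH: "stuck S D (\<lambda>s. P s = False) A (mm t) (HH t) (ee t) (ll t)"
    "range (HH t) \<subseteq> range (\<lambda>x. H1 (t @ x))" if "length t = m1" for t
    using that by auto
  define z where "z t x = (SOME z. HH t x = H1 (t @ z))" for t x
  have z: "HH t x = H1 (t @ z t x)" if "length t = m1" for t x
  proof -
    have "\<exists>z. HH t x = H1 (t @ z)" using HH(2)[OF that] by blast
    then show ?thesis unfolding z_def by (rule someI_ex)
  qed
  have H1: "embedding H1" "string_computable A H1" "D \<sqsubseteq> A"
    using c1 A(1) string_computable_reducible reducible_trans unfolding condition_def by blast+
  have HHe: "embedding (HH t)" "string_computable A (HH t)" if "length t = m1" for t
    using HH(1)[OF that] unfolding stuck_def condition_def by blast+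
  \<comment> \<open>These pairs list all cones of the stuck conditions for \<open>False\<close>; the
    conditions built for \<open>True\<close> use no other cones.\<close>
  define X where "X = Sigma (lev m1) (\<lambda>t. lev (mm t))"
  have "finite X" unfolding X_def lev_def by (intro finite_SigmaI finite_length_eq)
  from finite_imp_inj_to_nat_seg[OF this] obtain N :: nat and ix where ix: "ix ` X = {i. i < N}" "inj_on ix X"
    by (elim exE conjE) (erule (1) that)
  have ix_less: "ix (t, r) < N" if "length t = m1" "length r = mm t" for t r
    using ix(1) that by (auto simp: X_def lev_def)
  define U where "U i x = (case inv_into X ix i of (t, r) \<Rightarrow> HH t (r @ x))" for i x
  have U: "U (ix (t, r)) x = HH t (r @ x)" if "length t = m1" "length r = mm t" for t r x
    using that ix(2) by (simp add: U_def X_def lev_def)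
  \<comment> \<open>A member selects one cone from each condition for \<open>False\<close>.
    \<open>PiE\<close> fixes the values elsewhere, so there are only finitely many
    selections.\<close>
  define \<Phi> where "\<Phi> = PiE (lev m1) (\<lambda>t. lev (mm t))"
  \<comment> \<open>The reservoir above \<open>t\<close> is replaced by the selected cone, which
    lies inside it. The result extends the first stuck condition and so is stuck again.\<close>
  define Hc where "Hc \<phi> = glue m1 H1 (\<lambda>t x. HH t (\<phi> t @ x))" for \<phi>
  have Hc_stuck: "stuck S D (\<lambda>s. P s = True) A m1 (Hc \<phi>) e1 l1" for \<phi>
  proof (rule stuck_extends[OF st1 A(1)])
    have inc: "prefix (H1 s) (H1 t) \<longleftrightarrow> prefix s t" for s t using H1(1) by (simp add: embedding_def)
    have "embedding (Hc \<phi>)" unfolding Hc_def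
    proof (rule embedding_glue)
      show "prefix (H1 s) (HH t (\<phi> t @ x)) \<longleftrightarrow> prefix s t" if "length s < m1" "length t = m1" for s t x
        using that by (auto simp: z inc prefix_append)
      show "\<not> prefix (HH t (\<phi> t @ x)) (H1 s)" if "length s < m1" "length t = m1" for s t x
        using that by (auto simp: z inc dest: prefix_length_le)
      show "t = t'" if "length t = m1" "length t' = m1" "prefix (HH t (\<phi> t @ x)) (HH t' (\<phi> t' @ y))" for t t' x y
        using that by (auto simp: z inc elim!: prefixE)
      show "embedding (\<lambda>x. HH t (\<phi> t @ x))" if "length t = m1" for t
        using embedding_comp[OF HHe(1)[OF that] embedding_append] .
    qed (rule inc)
    moreover have "string_computable A (Hc \<phi>)" unfolding Hc_def
      using string_computable_comp[OF HHe(2) string_computable_append] by (rule string_computable_glue)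
    ultimately show "condition S D (\<lambda>s. P s = True) A m1 (Hc \<phi>)"
      using c1 H1(3) A(2) by (simp add: condition_def Hc_def glue_def)
    show "extends m1 H1 m1 (Hc \<phi>)"
      unfolding extends_def Hc_def by (auto simp: glue_def z)
  qed
  interpret players S D A P "Inl ` \<Phi> \<union> Inr ` lev m1"
    "case_sum (\<lambda>_. True) (\<lambda>_. False)" "case_sum (\<lambda>_. m1) mm" "case_sum Hc HH"
    "case_sum (\<lambda>_. e1) ee" "case_sum (\<lambda>_. l1) ll" N
    "case_sum (\<lambda>\<phi> t. ix (t, \<phi> t)) (\<lambda>t r. ix (t, r))" U
  proof
    show "finite (Inl ` \<Phi> \<union> Inr ` lev m1)"
      unfolding \<Phi>_def lev_def by (intro finite_UnI finite_imageI finite_PiE finite_length_eq)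
    show "good S A" by (rule A(2))
    show "\<exists>i\<in>Inl ` \<Phi> \<union> Inr ` lev m1. \<forall>t. length t = case_sum (\<lambda>_. m1) mm i \<longrightarrow>
      \<gamma> (case_sum (\<lambda>\<phi> t. ix (t, \<phi> t)) (\<lambda>t r. ix (t, r)) i t) = case_sum (\<lambda>_. True) (\<lambda>_. False) i"
      for \<gamma> :: "nat \<Rightarrow> bool"
    proof (cases "\<exists>t\<in>lev m1. \<forall>r\<in>lev (mm t). \<not> \<gamma> (ix (t, r))")
      case True
      then obtain t where "t \<in> lev m1" "\<And>r. r \<in> lev (mm t) \<Longrightarrow> \<not> \<gamma> (ix (t, r))" by blast
      then show ?thesis by (intro bexI[of _ "Inr t"]) (auto simp: lev_def)
    next
      case False
      then have "\<forall>t\<in>lev m1. \<exists>r. r \<in> lev (mm t) \<and> \<gamma> (ix (t, r))" by blast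
      from bchoice[OF this] obtain \<phi> where \<phi>: "\<forall>t\<in>lev m1. \<phi> t \<in> lev (mm t) \<and> \<gamma> (ix (t, \<phi> t))" ..
      then have "restrict \<phi> (lev m1) \<in> \<Phi>" unfolding \<Phi>_def by auto
      then show ?thesis using \<phi> by (intro bexI[of _ "Inl (restrict \<phi> (lev m1))"]) (auto simp: lev_def)
    qed
    fix i :: "(bool list \<Rightarrow> bool list) + bool list"
    assume i: "i \<in> Inl ` \<Phi> \<union> Inr ` lev m1"
    show "stuck S D (\<lambda>s. P s = case_sum (\<lambda>_. True) (\<lambda>_. False) i) A (case_sum (\<lambda>_. m1) mm i)
      (case_sum Hc HH i) (case_sum (\<lambda>_. e1) ee i) (case_sum (\<lambda>_. l1) ll i)"
      using i HH(1) Hc_stuck by (auto simp: lev_def)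
    fix t :: "bool list" assume t: "length t = case_sum (\<lambda>_. m1) mm i"
    have \<Phi>: "\<And>\<phi>. \<phi> \<in> \<Phi> \<Longrightarrow> length t = m1 \<Longrightarrow> length (\<phi> t) = mm t" by (auto simp: \<Phi>_def lev_def)
    show "case_sum (\<lambda>\<phi> t. ix (t, \<phi> t)) (\<lambda>t r. ix (t, r)) i t < N"
      using i t \<Phi> ix_less by (auto simp: lev_def)
    show "case_sum Hc HH i (t @ x) = U (case_sum (\<lambda>\<phi> t. ix (t, \<phi> t)) (\<lambda>t r. ix (t, r)) i t) x" for x
      using i t \<Phi> by (auto simp: lev_def U Hc_def glue_def)
  qed
  from av show False by (rule contradiction)
qed

text \<open>Colours are split off one at a time: either \<open>b\<close> alone has a solution, or
  its complement does and one colour is lost.\<close>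

lemma monochromatic_embedding:
  assumes av: "Pi01_class_avoidance k" "k \<ge> 2"
    and "finite B" "good S A" "embedding h" "string_computable A h" "\<And>s. C (h s) \<in> B"
  shows "\<exists>A' g a. A \<sqsubseteq> A' \<and> good S A' \<and> embedding g \<and> string_computable A' g \<and> (\<forall>s. C (g s) = a)"
  using assms(3-)
proof (induction B arbitrary: A h)
  case (insert b B)
  from solvable_or_complement[OF av insert.prems(1), of "\<lambda>s. C (h s) = b"]
  obtain A' g where 1: "A \<sqsubseteq> A'" "good S A'" "embedding g" "string_computable A' g"
    "(\<forall>s. C (h (g s)) = b) \<or> (\<forall>s. C (h (g s)) \<noteq> b)"
    unfolding solvable_def by blast
  have hg: "embedding (\<lambda>s. h (g s))" "string_computable A' (\<lambda>s. h (g s))"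
    using embedding_comp[OF insert.prems(2) 1(3)]
      string_computable_comp[OF string_computable_reducible[OF insert.prems(3) 1(1)] 1(4)] .
  from 1(5) show ?case
  proof
    assume "\<forall>s. C (h (g s)) = b"
    then show ?thesis using 1(1,2) hg by blast
  next
    assume "\<forall>s. C (h (g s)) \<noteq> b"
    then have "C (h (g s)) \<in> B" for s using insert.prems(4)[of "g s"] by auto
    from insert.IH[OF 1(2) hg this] show ?thesis using reducible_trans[OF 1(1)] by blast
  qed
qed simp

theorem theorem4p3:
  fixes k :: nat
  assumes "k \<ge> 1"
  shows "strong_avoidance k \<longleftrightarrow> Pi01_class_avoidance k"
proof
  assume strong: "strong_avoidance k"
  show "Pi01_class_avoidance k" unfolding Pi01_class_avoidance_def
  proof (intro allI impI)
    fix D S Q assume DS: "\<not> computes_bounded_enumeration D S" and Q: "Pi01_class D k Q \<and> Q \<noteq> {}"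
    \<comment> \<open>Any member of the class will do, since strong avoidance applies to every
      colouring.\<close>
    then obtain C where "C \<in> Q" "C \<in> colorings k" unfolding Pi01_class_def by blast
    then show "\<exists>C\<in>Q. \<exists>T. TT1_solution C T \<and> \<not> computes_bounded_enumeration (join D (string_code ` T)) S"
      using strong DS unfolding strong_avoidance_def by blast
  qed
next
  assume av: "Pi01_class_avoidance k"
  show "strong_avoidance k" unfolding strong_avoidance_def
  proof (intro allI impI ballI)
    fix D S C assume DS: "\<not> computes_bounded_enumeration D S" and C: "C \<in> colorings k"
    have good: "good S D" using DS unfolding good_def .
    have "\<exists>A g a. D \<sqsubseteq> A \<and> good S A \<and> embedding g \<and> string_computable A g \<and> (\<forall>s. C (g s) = a)"
    proof (cases "k = 1")
      case True
      \<comment> \<open>With a single colour the whole tree is a solution; the separation of colours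
        requires two.\<close>
      then have "C s = 0" for s using C by (auto simp: colorings_def)
      then show ?thesis using good reducible_refl embedding_id string_computable_id by blast
    next
      case False
      with assms have "k \<ge> 2" by simp
      then show ?thesis
        by (rule monochromatic_embedding[OF av _ finite_lessThan good embedding_id string_computable_id])
          (use C in \<open>auto simp: colorings_def\<close>)
    qed
    then obtain A g a where g: "D \<sqsubseteq> A" "good S A" "embedding g" "string_computable A g" "\<And>s. C (g s) = a"
      by blast
    have "TT1_solution C (range g)"
      unfolding TT1_solution_def using perfect_tree_range[OF g(3)] g(5) by blast
    moreover have "good S (join D (string_code ` range g))"
      using good_reducible[OF g(2) join_reducible[OF g(1) range_reducible[OF g(3,4)]]] .
    ultimately show "\<exists>T. TT1_solution C T \<and> \<not> computes_bounded_enumeration (join D (string_code ` T)) S"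
      unfolding good_def by blast
  qed
qed

end
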